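(* Let $K$ be a (non-degenerate, shape-regular) parallelogram of diameter $h_K$ and $\mathbb{X}(K)=\operatorname{sym}(\boldsymbol Q^0(K)\otimes\boldsymbol{RT}^1(K))$. The elements of $$\mathbb{B}:=\{\boldsymbol N^\square_{(j,k)},\boldsymbol T^\square_{(j,k)},\boldsymbol J^\square_j: j=1,2,3,4,\ k=0,1\}$$ define a basis of $\mathbb{X}(K)$ and are dual to the degrees of freedom $$\tfrac{1}{\|\ell_{E_\ell,m}\|^2_{E_\ell}}\langle\mathrm{tr}_{K,E_\ell,\boldsymbol n}\boldsymbol M,\ell_{E_\ell,m}\rangle_{E_\ell},\quad\langle\mathrm{tr}_{K,E_\ell,\boldsymbol t}\boldsymbol M,\ell_{E_\ell,m}\rangle_{E_\ell},\quad[\boldsymbol t\cdot\boldsymbol M\boldsymbol n]_{\partial K}(z_\ell)\qquad(\ell=1,2,3,4,\ m=0,1),$$ where $\boldsymbol N^\square_{(j,k)}$, $\boldsymbol T^\square_{(j,k)}$, $\boldsymbol J^\square_j$ correspond to the functionals of the first, second and third type with $(\ell,m)=(j,k)$, $(\ell,m)=(j,k)$, $\ell=j$, respectively. Moreover, $\|\boldsymbol B\|_K\eqsim h_K$ for all $\boldsymbol B\in\mathbb{B}$, with equivalence constants depending only on the shape-regularity of $K$.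
   Context: $\boldsymbol{RT}^p(K)=P^p(K)^2\oplus\boldsymbol xP^p_{\mathrm{hom}}(K)$, where $P^p(K)$ are polynomials of total degree $\le p$, $P^p_{\mathrm{hom}}(K)$ the homogeneous ones, $\boldsymbol x:(x,y)\mapsto(x,y)^\top$; $\operatorname{sym}(\boldsymbol M)=\frac12(\boldsymbol M+\boldsymbol M^\top)$ (applied to spaces: image); $\boldsymbol X\otimes\boldsymbol Y=\operatorname{span}\{\boldsymbol\phi\boldsymbol\psi^\top\}$. $\|\cdot\|_K$, $\langle\cdot,\cdot\rangle_E$, $\|\cdot\|_E$: $L_2$ norm on $K$, inner product and norm on $E$. Geometry. $\widehat K=(0,1)^2$ with vertices $\widehat z_1=(0,0),\widehat z_2=(1,0),\widehat z_3=(1,1),\widehat z_4=(0,1)$. $K$ has vertices $z_1,z_2,z_3,z_4$ (positive order); $F_K(\widehat{\boldsymbol x})=\boldsymbol B_K\widehat{\boldsymbol x}+z_1$, $\boldsymbol B_K=(z_2-z_1\;\;z_4-z_1)$. Edge $E_j$ goes from $z_j$ to $z_{j+1}$ (cyclic indices modulo 4), with unit tangent $\boldsymbol t_j$ (positive orientation) and unit exterior normal $\boldsymbol n_j$. $\widehat\eta_j$ is the bilinear function on $\widehat K$ with $\widehat\eta_j(\widehat z_k)=\delta_{jk}$ and $\eta_j\circ F_K=\widehat\eta_j$. Hatted symbols refer to $\widehat K$. $\mathcal{H}_K$: Piola–Kirchhoff transformation, $\boldsymbol M=\mathcal{H}_K(\widehat{\boldsymbol M})$ with $\det(\boldsymbol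 B_K)\boldsymbol M\circ F_K=\boldsymbol B_K\widehat{\boldsymbol M}\boldsymbol B_K^\top$. $\boldsymbol Q^0(K)$ is the set of $\boldsymbol\phi$ with $\det(\boldsymbol B_K)\boldsymbol\phi\circ F_K=\boldsymbol B_K\widehat{\boldsymbol\phi}$, $\widehat{\boldsymbol\phi}\in\operatorname{span}\{(1,0)^\top,(0,1)^\top,(x,0)^\top,(0,y)^\top\}$. Traces (for $K$ and likewise $\widehat K$). $\mathrm{tr}_{K,E,\boldsymbol n}\boldsymbol M=\boldsymbol n\cdot\boldsymbol M\boldsymbol n|_E$; $\mathrm{tr}_{K,E,\boldsymbol t}\boldsymbol M=(\boldsymbol n\cdot\mathbf{div}\boldsymbol M+\partial_{\boldsymbol t}(\boldsymbol t\cdot\boldsymbol M\boldsymbol n))|_E$ ($\mathbf{div}$ row-wise); $[\boldsymbol t\cdot\boldsymbol M\boldsymbol n]_{\partial K}(z_j)=(\boldsymbol t\cdot\boldsymbol M\boldsymbol n)|_{E_{j-1}}(z_j)-(\boldsymbol t\cdot\boldsymbol M\boldsymbol n)|_{E_j}(z_j)$. $\ell_{E,k}$: Legendre polynomial of degree $k$ on $E$ with value $1$ at the end point of $E$. Tensors $\boldsymbol T^\square_{(j,k)}=\mathcal{H}_K(\widehat{\boldsymbol T}^\square_{(j,k)})$, where (writing symmetric tensors as $(M_{11},M_{12},M_{22})$) $\widehat{\boldsymbol T}^\square_{(1,0)}=(\frac{x(2y-1)(x-1)}4,\ -\frac{y(2x-1)(y-1)}8,\ -y(y-1)^2)$; $\widehat{\boldsymbol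 T}^\square_{(1,1)}=(0,\ \frac{3x(2y-3)(x-1)}8,\ \frac{3y(2x-1)(y-1)}4)$; $\widehat{\boldsymbol T}^\square_{(2,0)}=(x^2(x-1),\ \frac{x(2y-1)(x-1)}8,\ -\frac{y(2x-1)(y-1)}4)$; $\widehat{\boldsymbol T}^\square_{(2,1)}=(\frac{3x(2y-1)(x-1)}4,\ \frac{3y(2x+1)(y-1)}8,\ 0)$; $\widehat{\boldsymbol T}^\square_{(3,0)}=(-\frac{x(2y-1)(x-1)}4,\ \frac{y(2x-1)(y-1)}8,\ y^2(y-1))$; $\widehat{\boldsymbol T}^\square_{(3,1)}=(0,\ -\frac{3x(2y+1)(x-1)}8,\ -\frac{3y(2x-1)(y-1)}4)$; $\widehat{\boldsymbol T}^\square_{(4,0)}=(-x(x-1)^2,\ -\frac{x(2y-1)(x-1)}8,\ \frac{y(2x-1)(y-1)}4)$; $\widehat{\boldsymbol T}^\square_{(4,1)}=(-\frac{3x(2y-1)(x-1)}4,\ -\frac{3y(2x-3)(y-1)}8,\ 0)$. Tensors $\boldsymbol J^\square_j=\mathcal{H}_K(\widehat{\boldsymbol J}^\square_j)$ with $\widetilde{\boldsymbol J}^\square_j=\operatorname{sym}(\widehat{\boldsymbol t}_j\widehat{\boldsymbol t}_{j+1}^\top)\widehat\eta_j$ and $\widehat{\boldsymbol J}^\square_j=\widetilde{\boldsymbol J}^\square_j-\sum_{\ell=1}^4\langle\mathrm{tr}_{\widehat K,\widehat E_\ell,\boldsymbol t}\widetilde{\boldsymbol J}^\square_j,1\rangle_{\widehat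 E_\ell}\widehat{\boldsymbol T}^\square_{(\ell,0)}$. Tensors $\boldsymbol N^\square_{(j,k)}$: with $\widetilde{\boldsymbol N}^\square_{(j,0)}=\frac{1}{|\boldsymbol t_{j+1}\cdot\boldsymbol n_j|^2}\boldsymbol t_{j+1}\boldsymbol t_{j+1}^\top(\eta_j+\eta_{j+1})$ and $\widetilde{\boldsymbol N}^\square_{(j,1)}=\frac{1}{|\boldsymbol t_{j+1}\cdot\boldsymbol n_j|^2}\boldsymbol t_{j+1}\boldsymbol t_{j+1}^\top(\eta_{j+1}-\eta_j)$, for $m=0,1$, $\boldsymbol N^\square_{(j,m)}=\widetilde{\boldsymbol N}^\square_{(j,m)}-\sum_{\ell=1}^4\sum_{k=0}^1\langle\mathrm{tr}_{K,E_\ell,\boldsymbol t}\widetilde{\boldsymbol N}^\square_{(j,m)},\ell_{E_\ell,k}\rangle_{E_\ell}\boldsymbol T^\square_{(\ell,k)}-\sum_{\ell=1}^4[\boldsymbol t\cdot\widetilde{\boldsymbol N}^\square_{(j,m)}\boldsymbol n]_{\partial K}(z_\ell)\boldsymbol J^\square_\ell$. *)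

theory Defs
  imports "HOL-Analysis.Analysis" "HOL-Library.Function_Algebras"
begin

text \<open>Functions into a real vector space form a real vector space (pointwise operations), so that
  \<^const>\<open>span\<close> and \<^const>\<open>independent\<close> apply to spaces of fields.\<close>

instantiation "fun" :: (type, real_vector) real_vector
begin

definition scaleR_fun :: "real \<Rightarrow> ('a \<Rightarrow> 'b) \<Rightarrow> 'a \<Rightarrow> 'b" where
  "scaleR_fun c f = (\<lambda>x. c *\<^sub>R f x)"

instance
  by standard (auto simp: scaleR_fun_def fun_eq_iff plus_fun_def algebra_simps)

end

text \<open>All fields are polynomial, and a polynomial on an element with non-empty interior is
  represented by its unique polynomial extension to the whole plane. Traces on edges then need no
  one-sided derivatives, and the polynomial spaces do not depend on the element.\<close>

type_synonym point = "real ^ 2"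
type_synonym scalar_field = "point \<Rightarrow> real"
type_synonym vector_field = "point \<Rightarrow> real ^ 2"
type_synonym tensor_field = "point \<Rightarrow> real ^ 2 ^ 2"

definition Pol :: "nat \<Rightarrow> scalar_field set" where
  "Pol p = span {\<lambda>x. (x $ 1) ^ i * (x $ 2) ^ j | i j. i + j \<le> p}"

definition Pol_hom :: "nat \<Rightarrow> scalar_field set" where
  "Pol_hom p = span {\<lambda>x. (x $ 1) ^ i * (x $ 2) ^ j | i j. i + j = p}"

definition RT :: "nat \<Rightarrow> vector_field set" where
  "RT p = {\<lambda>x. u x + q x *\<^sub>R x | u q. (\<forall>i. (\<lambda>x. u x $ i) \<in> Pol p) \<and> q \<in> Pol_hom p}"

definition sym_part :: "real ^ 2 ^ 2 \<Rightarrow> real ^ 2 ^ 2" where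
  "sym_part M = (1 / 2) *\<^sub>R (M + transpose M)"

definition outer :: "real ^ 2 \<Rightarrow> real ^ 2 \<Rightarrow> real ^ 2 ^ 2" where
  "outer v w = (\<chi> i j. v $ i * w $ j)"

definition tensor_space :: "vector_field set \<Rightarrow> vector_field set \<Rightarrow> tensor_field set" where
  "tensor_space X Y = span {\<lambda>x. outer (\<phi> x) (\<psi> x) | \<phi> \<psi>. \<phi> \<in> X \<and> \<psi> \<in> Y}"

text \<open>A quadrilateral is given by its vertices, indexed by the type \<^typ>\<open>4\<close>. Arithmetic on this
  type is modulo 4 (in particular its elements are 1, 2, 3 and 4 = 0), so that indices are cyclic.\<close>

type_synonym vertices = "4 \<Rightarrow> point"

definition B_mat :: "vertices \<Rightarrow> real ^ 2 ^ 2" where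
  "B_mat z = transpose (vector [z 2 - z 1, z 4 - z 1])"

definition F_map :: "vertices \<Rightarrow> point \<Rightarrow> point" where
  "F_map z xh = B_mat z *v xh + z 1"

text \<open>Non-degenerate, with the vertices in positive (counterclockwise) order.\<close>

definition parallelogram :: "vertices \<Rightarrow> bool" where
  "parallelogram z \<longleftrightarrow> z 3 - z 4 = z 2 - z 1 \<and> det (B_mat z) > 0"

definition element :: "vertices \<Rightarrow> point set" where
  "element z = F_map z ` box 0 1"

definition ref_vertex :: vertices where
  "ref_vertex j = (if j = 1 then vector [0, 0] else if j = 2 then vector [1, 0]
     else if j = 3 then vector [1, 1] else vector [0, 1])"

definition edge_len :: "vertices \<Rightarrow> 4 \<Rightarrow> real" where
  "edge_len z j = dist (z j) (z (j + 1))"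

definition tangent :: "vertices \<Rightarrow> 4 \<Rightarrow> real ^ 2" where
  "tangent z j = (1 / edge_len z j) *\<^sub>R (z (j + 1) - z j)"

text \<open>The tangent rotated clockwise by a right angle; this is the exterior normal because the
  vertices are in counterclockwise order (lemma \<open>normal_exterior\<close>).\<close>

definition normal :: "vertices \<Rightarrow> 4 \<Rightarrow> real ^ 2" where
  "normal z j = vector [tangent z j $ 2, - (tangent z j $ 1)]"

definition eta_hat :: "4 \<Rightarrow> scalar_field" where
  "eta_hat j x = (if j = 1 then (1 - x $ 1) * (1 - x $ 2) else if j = 2 then x $ 1 * (1 - x $ 2)
     else if j = 3 then x $ 1 * x $ 2 else (1 - x $ 1) * x $ 2)"

definition eta :: "vertices \<Rightarrow> 4 \<Rightarrow> scalar_field" where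
  "eta z j = eta_hat j \<circ> inv (F_map z)"

definition PK :: "vertices \<Rightarrow> tensor_field \<Rightarrow> tensor_field" where
  "PK z Mh x = (1 / det (B_mat z)) *\<^sub>R (B_mat z ** Mh (inv (F_map z) x) ** transpose (B_mat z))"

definition Q0 :: "vertices \<Rightarrow> vector_field set" where
  "Q0 z = {\<phi>. \<exists>\<phi>h \<in> span {\<lambda>x. vector [1, 0], \<lambda>x. vector [0, 1],
                          \<lambda>x. vector [x $ 1, 0], \<lambda>x. vector [0, x $ 2]}.
             \<forall>xh. det (B_mat z) *\<^sub>R \<phi> (F_map z xh) = B_mat z *v \<phi>h xh}"

definition X_space :: "vertices \<Rightarrow> tensor_field set" where
  "X_space z = (\<lambda>M x. sym_part (M x)) ` tensor_space (Q0 z) (RT 1)"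

definition dir_deriv :: "real ^ 2 \<Rightarrow> scalar_field \<Rightarrow> scalar_field" where
  "dir_deriv v f x = frechet_derivative f (at x) v"

definition row_div :: "tensor_field \<Rightarrow> vector_field" where
  "row_div M x = (\<chi> i. \<Sum>j\<in>UNIV. dir_deriv (axis j 1) (\<lambda>y. M y $ i $ j) x)"

definition tn_comp :: "vertices \<Rightarrow> 4 \<Rightarrow> tensor_field \<Rightarrow> scalar_field" where
  "tn_comp z j M x = tangent z j \<bullet> (M x *v normal z j)"

definition tr_n :: "vertices \<Rightarrow> 4 \<Rightarrow> tensor_field \<Rightarrow> scalar_field" where
  "tr_n z j M x = normal z j \<bullet> (M x *v normal z j)"

definition tr_t :: "vertices \<Rightarrow> 4 \<Rightarrow> tensor_field \<Rightarrow> scalar_field" where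
  "tr_t z j M x = normal z j \<bullet> row_div M x + dir_deriv (tangent z j) (tn_comp z j M) x"

definition jump :: "vertices \<Rightarrow> 4 \<Rightarrow> tensor_field \<Rightarrow> real" where
  "jump z j M = tn_comp z (j - 1) M (z j) - tn_comp z j M (z j)"

text \<open>Inner product in \<open>L\<^sub>2(E\<^sub>j)\<close>, by arc length.\<close>

definition edge_inner :: "vertices \<Rightarrow> 4 \<Rightarrow> scalar_field \<Rightarrow> scalar_field \<Rightarrow> real" where
  "edge_inner z j f g = integral {0..edge_len z j}
     (\<lambda>s. f (z j + s *\<^sub>R tangent z j) * g (z j + s *\<^sub>R tangent z j))"

definition edge_norm :: "vertices \<Rightarrow> 4 \<Rightarrow> scalar_field \<Rightarrow> real" where
  "edge_norm z j f = sqrt (edge_inner z j f f)"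

text \<open>Legendre polynomials on \<open>[-1, 1]\<close>, by Bonnet's recursion; normalised to take the value 1 at 1.\<close>

fun legendre :: "nat \<Rightarrow> real \<Rightarrow> real" where
  "legendre 0 s = 1"
| "legendre (Suc 0) s = s"
| "legendre (Suc (Suc n)) s =
     ((2 * real n + 3) * s * legendre (Suc n) s - (real n + 1) * legendre n s) / (real n + 2)"

definition edge_legendre :: "vertices \<Rightarrow> 4 \<Rightarrow> nat \<Rightarrow> scalar_field" where
  "edge_legendre z j k x = legendre k (2 * ((x - z j) \<bullet> tangent z j) / edge_len z j - 1)"

text \<open>The norm on \<^typ>\<open>real ^ 2 ^ 2\<close> is the Frobenius norm.\<close>

definition L2_norm_on :: "point set \<Rightarrow> tensor_field \<Rightarrow> real" where
  "L2_norm_on K M = sqrt (integral K (\<lambda>x. (norm (M x))\<^sup>2))"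

definition sym_mat :: "real \<Rightarrow> real \<Rightarrow> real \<Rightarrow> real ^ 2 ^ 2" where
  "sym_mat a b c = vector [vector [a, b], vector [b, c]]"

definition T_hat :: "4 \<Rightarrow> nat \<Rightarrow> tensor_field" where
  "T_hat j k p = (let x = p $ 1; y = p $ 2 in
     if k = 0 then
       if j = 1 then sym_mat (x * (2*y - 1) * (x - 1) / 4)
                             (- (y * (2*x - 1) * (y - 1) / 8))
                             (- (y * (y - 1)\<^sup>2))
       else if j = 2 then sym_mat (x\<^sup>2 * (x - 1))
                                  (x * (2*y - 1) * (x - 1) / 8)
                                  (- (y * (2*x - 1) * (y - 1) / 4))
       else if j = 3 then sym_mat (- (x * (2*y - 1) * (x - 1) / 4))
                                  (y * (2*x - 1) * (y - 1) / 8)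
                                  (y\<^sup>2 * (y - 1))
       else sym_mat (- (x * (x - 1)\<^sup>2))
                    (- (x * (2*y - 1) * (x - 1) / 8))
                    (y * (2*x - 1) * (y - 1) / 4)
     else
       if j = 1 then sym_mat 0
                             (3 * x * (2*y - 3) * (x - 1) / 8)
                             (3 * y * (2*x - 1) * (y - 1) / 4)
       else if j = 2 then sym_mat (3 * x * (2*y - 1) * (x - 1) / 4)
                                  (3 * y * (2*x + 1) * (y - 1) / 8)
                                  0
       else if j = 3 then sym_mat 0
                                  (- (3 * x * (2*y + 1) * (x - 1) / 8))
                                  (- (3 * y * (2*x - 1) * (y - 1) / 4))
       else sym_mat (- (3 * x * (2*y - 1) * (x - 1) / 4))
                    (- (3 * y * (2*x - 3) * (y - 1) / 8))
                    0)"

definition T_tensor :: "vertices \<Rightarrow> 4 \<Rightarrow> nat \<Rightarrow> tensor_field" where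
  "T_tensor z j k = PK z (T_hat j k)"

definition J_tilde_hat :: "4 \<Rightarrow> tensor_field" where
  "J_tilde_hat j x =
     eta_hat j x *\<^sub>R sym_part (outer (tangent ref_vertex j) (tangent ref_vertex (j + 1)))"

definition J_hat :: "4 \<Rightarrow> tensor_field" where
  "J_hat j = J_tilde_hat j -
     (\<Sum>l\<in>UNIV. edge_inner ref_vertex l (tr_t ref_vertex l (J_tilde_hat j)) (\<lambda>_. 1) *\<^sub>R T_hat l 0)"

definition J_tensor :: "vertices \<Rightarrow> 4 \<Rightarrow> tensor_field" where
  "J_tensor z j = PK z (J_hat j)"

definition N_tilde :: "vertices \<Rightarrow> 4 \<Rightarrow> nat \<Rightarrow> tensor_field" where
  "N_tilde z j m x =
     ((1 / \<bar>tangent z (j + 1) \<bullet> normal z j\<bar>\<^sup>2) *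
      (if m = 0 then eta z j x + eta z (j + 1) x else eta z (j + 1) x - eta z j x))
     *\<^sub>R outer (tangent z (j + 1)) (tangent z (j + 1))"

definition N_tensor :: "vertices \<Rightarrow> 4 \<Rightarrow> nat \<Rightarrow> tensor_field" where
  "N_tensor z j m = N_tilde z j m
     - (\<Sum>l\<in>UNIV. \<Sum>k\<in>{0, 1}.
          edge_inner z l (tr_t z l (N_tilde z j m)) (edge_legendre z l k) *\<^sub>R T_tensor z l k)
     - (\<Sum>l\<in>UNIV. jump z l (N_tilde z j m) *\<^sub>R J_tensor z l)"

definition basis_tensors :: "vertices \<Rightarrow> tensor_field set" where
  "basis_tensors z = {N_tensor z j k | j k. k \<in> {0, 1}} \<union> {T_tensor z j k | j k. k \<in> {0, 1}}
                     \<union> range (J_tensor z)"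

definition dof_n :: "vertices \<Rightarrow> 4 \<Rightarrow> nat \<Rightarrow> tensor_field \<Rightarrow> real" where
  "dof_n z l m M = 1 / (edge_norm z l (edge_legendre z l m))\<^sup>2
                   * edge_inner z l (tr_n z l M) (edge_legendre z l m)"

definition dof_t :: "vertices \<Rightarrow> 4 \<Rightarrow> nat \<Rightarrow> tensor_field \<Rightarrow> real" where
  "dof_t z l m M = edge_inner z l (tr_t z l M) (edge_legendre z l m)"

text \<open>The element contains a disc whose diameter is at least the fraction \<open>1 / \<sigma>\<close> of the
  diameter of the element.\<close>

definition shape_regular :: "real \<Rightarrow> vertices \<Rightarrow> bool" where
  "shape_regular \<sigma> z \<longleftrightarrow> (\<exists>c r. ball c r \<subseteq> element z \<and> diameter (element z) \<le> \<sigma> * (2 * r))"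

lemma det_B_mat: "det (B_mat z) = (z 2 - z 1) $ 1 * (z 4 - z 1) $ 2 - (z 4 - z 1) $ 1 * (z 2 - z 1) $ 2"
  by (simp add: B_mat_def det_2 transpose_def)

lemma inv_F_map:
  assumes "det (B_mat z) \<noteq> 0"
  shows "inv (F_map z) (F_map z xh) = xh"
proof -
  have "invertible (B_mat z)"
    using assms by (simp add: invertible_det_nz)
  then have "inj (F_map z)"
    by (metis (no_types, lifting) F_map_def add_right_cancel injI inj_matrix_vector_mult injD)
  then show ?thesis
    by simp
qed

lemma PK_F_map:
  assumes "det (B_mat z) \<noteq> 0"
  shows "det (B_mat z) *\<^sub>R PK z Mh (F_map z xh) = B_mat z ** Mh xh ** transpose (B_mat z)"
  using assms by (simp add: PK_def inv_F_map)

lemma F_map_ref_vertex: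
  assumes "parallelogram z"
  shows "F_map z (ref_vertex j) = z j"
proof -
  have *: "z 3 = z 2 + z 4 - z 1"
    using assms by (simp add: parallelogram_def algebra_simps)
  consider "j = 1" | "j = 2" | "j = 3" | "j = 4"
    using exhaust_4 by blast
  then show ?thesis
    by cases (simp_all add: F_map_def B_mat_def ref_vertex_def vec_eq_iff forall_2 sum_2
        matrix_vector_mult_def transpose_def *)
qed

lemma eta_hat_ref_vertex: "eta_hat j (ref_vertex k) = (if j = k then 1 else 0)"
  using exhaust_4[of j] exhaust_4[of k] by (auto simp: eta_hat_def ref_vertex_def)

lemma legendre_1: "legendre k 1 = 1"
  by (induction k rule: induct_nat_012) (auto simp: field_simps)

lemma normal_exterior:
  assumes "parallelogram z" and "x \<in> element z"
  shows "normal z j \<bullet> (x - z j) < 0"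
proof -
  obtain xh where xh: "x = F_map z xh" "0 < xh $ 1" "xh $ 1 < 1" "0 < xh $ 2" "xh $ 2 < 1"
    using assms(2) by (auto simp: element_def mem_box_cart)
  define a b where "a = z 2 - z 1" and "b = z 4 - z 1"
  have d: "a $ 1 * b $ 2 - b $ 1 * a $ 2 > 0"
    using assms(1) unfolding parallelogram_def det_B_mat a_def b_def by simp
  have z: "z 2 = z 1 + a" "z 4 = z 1 + b" "z 3 = z 1 + a + b"
    using assms(1) by (auto simp: parallelogram_def a_def b_def algebra_simps)
  have x: "x = z 1 + xh $ 1 *\<^sub>R a + xh $ 2 *\<^sub>R b"
    unfolding xh(1) by (simp add: F_map_def B_mat_def vec_eq_iff forall_2 sum_2
        matrix_vector_mult_def transpose_def a_def b_def)
  define c where "c = (if j = 1 then xh $ 2 else if j = 2 then 1 - xh $ 1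
                       else if j = 3 then 1 - xh $ 2 else xh $ 1)"
  have c: "c > 0"
    using xh by (simp add: c_def)
  have "(5 :: 4) = 1"
    by simp
  then have "z 5 = z 1"
    by (rule arg_cong)
  then have key: "(z (j+1) - z j) $ 2 * (x - z j) $ 1 - (z (j+1) - z j) $ 1 * (x - z j) $ 2
             = - c * (a $ 1 * b $ 2 - b $ 1 * a $ 2)"
    using exhaust_4[of j] by (auto simp: c_def z x algebra_simps)
  then have "z (j+1) \<noteq> z j"
    using c d by auto
  then have "edge_len z j > 0"
    by (simp add: edge_len_def)
  moreover have "normal z j \<bullet> (x - z j) = (1 / edge_len z j) *
     ((z (j+1) - z j) $ 2 * (x - z j) $ 1 - (z (j+1) - z j) $ 1 * (x - z j) $ 2)"
    by (simp add: normal_def tangent_def inner_vec_def sum_2 algebra_simps diff_divide_distrib)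
  ultimately show ?thesis
    unfolding key using c d by (simp add: mult_less_0_iff divide_less_0_iff)
qed

end

theory Submission
  imports Defs
begin

text \<open>Every field on the parallelogram \<open>K\<close> is written as the Piola--Kirchhoff image of a field on the
reference square. Let \<open>e\<^sub>l\<close> be the length of the edge \<open>E\<^sub>l\<close>, and let \<open>s\<^sub>l\<close> be the coefficient of
\<open>B t\<close> in the orthogonal projection of \<open>B n\<close> onto \<open>B t\<close>, where \<open>t\<close> and \<open>n\<close> are the reference
tangent and normal. On \<open>E\<^sub>l\<close> the image of a reference field \<open>M\<close> has the normal-normal trace
\<open>det B / e\<^sub>l\<^sup>2\<close> times that of \<open>M\<close>, the tangential-normal component \<open>t \<bullet> M n + s\<^sub>l (n \<bullet> M n)\<close>, and
\<open>e\<^sub>l\<close> times its trace \<open>tr\<^sub>t\<close> is \<open>tr\<^sub>t M + s\<^sub>l \<partial>\<^sub>t (n \<bullet> M n)\<close> (\<open>tr_n_PK\<close>, \<open>tn_comp_PK\<close>,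
\<open>tr_t_PK\<close>). The last two are therefore invariant as soon as the normal-normal trace vanishes.

This settles duality. The tensors \<open>T\<close> and \<open>J\<close> have vanishing normal-normal traces, so that their
degrees of freedom are those of fixed polynomial fields on the square and can be read off from
coefficients (\<open>T_coeffs_traces\<close>, \<open>J_coeffs_traces\<close>). The tensor from which \<open>N\<^sub>j\<close> is built is a
multiple of \<open>t t\<^sup>T\<close> for the direction \<open>t\<close> of the two edges adjacent to \<open>E\<^sub>j\<close>; its normal-normal
trace vanishes on these edges because \<open>t\<close> is tangential there, on the opposite edge because the
scalar factor does, and it is a Legendre polynomial on \<open>E\<^sub>j\<close>. Subtracting the combination of \<open>T\<close> and
\<open>J\<close> with the same degrees of freedom of the second and third type removes these and leaves those of
the first type alone (\<open>N_dofs\<close>).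

For the basis property, \<open>RT\<^sup>1\<close> consists of the fields \<open>u + A x + (w \<bullet> x) x\<close>, a form preserved by
affine maps, so that the space is the image of a family of reference fields with 20 coefficients
(\<open>X_space_eq\<close>). It contains 20 tensors with 20 dual functionals, which must form a basis
(\<open>dual_families\<close>).

For the norms, the \<open>L\<^sub>2\<close> norm on the square is equivalent to the norm of the 20 coefficients by
compactness (\<open>mass_equiv_norm\<close>), and the Piola--Kirchhoff transformation scales squared norms by
factors between \<open>det B ^ 3 / |B| ^ 4\<close> and \<open>|B| ^ 4 / det B\<close>, which shape regularity makes comparable
to \<open>h\<^sup>2\<close> for the diameter \<open>h\<close> of \<open>K\<close>. It remains to bound the coefficients of the basis uniformly from both sides. Those of \<open>T\<close> and
\<open>J\<close> are fixed and nonzero. Those of \<open>N\<^sub>j\<close> are bounded because all \<open>e\<^sub>l\<^sup>2 / det B\<close> and \<open>s\<^sub>l\<close> are, and stay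
away from zero because the reference normal-normal trace at an end point of \<open>E\<^sub>j\<close> equals
\<open>e\<^sub>j\<^sup>2 / det B\<close> (\<open>N_coeffs_upper\<close>, \<open>N_coeffs_lower\<close>).\<close>

section \<open>Affine images of the reference square\<close>

lemma exhaust_four:
  fixes l :: 4
  obtains "l = 1" | "l = 2" | "l = 3" | "l = 4"
  using exhaust_4[of l] by blast

lemma cyclic_five: "(5 :: 4) = 1"
  by simp

lemma ref_vertex_simps [simp]:
  "ref_vertex 1 = vector [0, 0]" "ref_vertex 2 = vector [1, 0]"
  "ref_vertex 3 = vector [1, 1]" "ref_vertex 4 = vector [0, 1]"
  by (simp_all add: ref_vertex_def)

lemma ref_diff:
  "ref_vertex (l + 1) - ref_vertex l =
     (if l = 1 then vector [1, 0] else if l = 2 then vector [0, 1]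
      else if l = 3 then vector [-1, 0] else vector [0, -1])"
  by (cases l rule: exhaust_four) (simp_all add: vec_eq_iff forall_2 cyclic_five)

lemma edge_len_ref [simp]: "edge_len ref_vertex l = 1"
proof -
  have "edge_len ref_vertex l = norm (ref_vertex (l + 1) - ref_vertex l)"
    by (simp add: edge_len_def dist_norm norm_minus_commute)
  then show ?thesis
    unfolding ref_diff by (cases l rule: exhaust_four) (simp_all add: norm_vec_def L2_set_def sum_2)
qed

lemma tangent_ref:
  "tangent ref_vertex l =
     (if l = 1 then vector [1, 0] else if l = 2 then vector [0, 1]
      else if l = 3 then vector [-1, 0] else vector [0, -1])"
  unfolding tangent_def edge_len_ref ref_diff by simp

lemma normal_ref:
  "normal ref_vertex l =
     (if l = 1 then vector [0, -1] else if l = 2 then vector [1, 0]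
      else if l = 3 then vector [0, 1] else vector [-1, 0])"
  unfolding normal_def tangent_ref by (simp add: vec_eq_iff forall_2)

definition edge_point :: "4 \<Rightarrow> real \<Rightarrow> point" where
  "edge_point l s = ref_vertex l + s *\<^sub>R tangent ref_vertex l"

text \<open>The rotation \<open>R\<close> by a right angle satisfies \<open>B\<^sup>T R B = det B \<cdot> R\<close>. This is what makes
normals transform by \<open>B\<^sup>-\<^sup>T\<close> up to scaling, see \<open>transpose_B_normal\<close>.\<close>

lemma rotated_adjugate:
  fixes B :: "real ^ 2 ^ 2" and v :: "real ^ 2"
  shows "transpose B *v vector [(B *v v) $ 2, - ((B *v v) $ 1)]
         = det B *\<^sub>R vector [v $ 2, - (v $ 1)]"
  by (simp add: vec_eq_iff forall_2 matrix_vector_mult_def transpose_def sum_2 det_2 algebra_simps)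

lemma inner_matrix_transpose:
  fixes A :: "real ^ 'n ^ 'm"
  shows "v \<bullet> (A *v w) = (transpose A *v v) \<bullet> w"
  by (simp add: dot_lmul_matrix)

locale parallelogram_element =
  fixes z :: vertices
  assumes parallelogram: "parallelogram z"
begin

abbreviation "B \<equiv> B_mat z"
abbreviation "F \<equiv> F_map z"

lemma det_pos: "det B > 0"
  using parallelogram by (simp add: parallelogram_def)

lemma inv_F [simp]: "inv F (F p) = p"
  using det_pos by (simp add: inv_F_map)

lemma F_inv [simp]: "F (inv F x) = x"
proof -
  have "invertible B"
    using det_pos by (simp add: invertible_det_nz)
  then obtain C where "B ** C = mat 1"
    by (auto simp: invertible_def)
  then have "F (C *v (x - z 1)) = x"
    by (simp add: F_map_def matrix_vector_mul_assoc)
  then show ?thesis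
    by (metis inv_F)
qed

lemma F_add_scaleR: "F (p + s *\<^sub>R v) = F p + s *\<^sub>R (B *v v)"
  by (simp add: F_map_def matrix_vector_right_distrib matrix_vector_mult_scaleR)

lemma vertex_eq: "z j = F (ref_vertex j)"
  using F_map_ref_vertex[OF parallelogram] by simp

lemma edge_vector: "z (l + 1) - z l = B *v tangent ref_vertex l"
proof -
  have "z (l + 1) - z l = F (ref_vertex (l + 1)) - F (ref_vertex l)"
    using vertex_eq[of "l + 1"] vertex_eq[of l] by (rule arg_cong2)
  also have "\<dots> = B *v (ref_vertex (l + 1) - ref_vertex l)"
    by (simp add: F_map_def matrix_vector_mult_diff_distrib)
  also have "ref_vertex (l + 1) - ref_vertex l = tangent ref_vertex l"
    by (simp add: tangent_def)
  finally show ?thesis .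
qed

lemma B_mult_eq_0_iff: "B *v v = 0 \<longleftrightarrow> v = 0"
proof
  assume "B *v v = 0"
  then have "F v = F 0"
    by (simp add: F_map_def)
  then show "v = 0"
    by (metis inv_F)
qed simp

lemma edge_len_eq: "edge_len z l = norm (B *v tangent ref_vertex l)"
  unfolding edge_vector[symmetric] by (simp add: edge_len_def dist_norm norm_minus_commute)

lemma edge_len_pos: "edge_len z l > 0"
proof -
  have "tangent ref_vertex l \<noteq> 0"
    by (cases l rule: exhaust_four) (auto simp: tangent_ref vec_eq_iff forall_2)
  then show ?thesis
    by (simp add: edge_len_eq B_mult_eq_0_iff)
qed

lemma tangent_eq: "tangent z l = (1 / edge_len z l) *\<^sub>R (B *v tangent ref_vertex l)"
  unfolding tangent_def[of z] edge_vector ..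

lemma transpose_B_normal:
  "transpose B *v normal z l = (det B / edge_len z l) *\<^sub>R normal ref_vertex l"
proof -
  have "normal z l = (1 / edge_len z l) *\<^sub>R
      vector [(B *v tangent ref_vertex l) $ 2, - ((B *v tangent ref_vertex l) $ 1)]"
    by (simp add: normal_def tangent_eq vec_eq_iff forall_2)
  then show ?thesis
    by (simp add: matrix_vector_mult_scaleR rotated_adjugate normal_def del: transpose_matrix_vector)
qed

text \<open>The coefficient of \<open>B t\<close> in the projection of \<open>B n\<close> onto \<open>B t\<close>, with \<open>t\<close> and \<open>n\<close> from the
reference edge. It vanishes for rectangles and measures by how much the transformation mixes
normal-normal parts into the tangential trace and the jump.\<close>

definition shear :: "4 \<Rightarrow> real" where
  "shear l = (B *v tangent ref_vertex l) \<bullet> (B *v normal ref_vertex l) / (edge_len z l)\<^sup>2"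

text \<open>Both components of \<open>B\<^sup>T t\<close> are read off in the orthonormal frame of the reference edge; the
normal one defines \<open>shear\<close>.\<close>

lemma transpose_B_tangent:
  "transpose B *v tangent z l
   = edge_len z l *\<^sub>R (tangent ref_vertex l + shear l *\<^sub>R normal ref_vertex l)"
proof -
  let ?t = "tangent ref_vertex l" and ?n = "normal ref_vertex l"
  have frame: "v = (v \<bullet> ?t) *\<^sub>R ?t + (v \<bullet> ?n) *\<^sub>R ?n" for v
    by (cases l rule: exhaust_four)
       (simp_all add: tangent_ref normal_ref vec_eq_iff forall_2 inner_vec_def sum_2)
  have t: "(transpose B *v (B *v ?t)) \<bullet> ?t = (edge_len z l)\<^sup>2"
    unfolding edge_len_eq power2_norm_eq_inner inner_matrix_transpose[of _ B] ..
  have n: "(transpose B *v (B *v ?t)) \<bullet> ?n = (edge_len z l)\<^sup>2 * shear l"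
    using edge_len_pos[of l] unfolding shear_def inner_matrix_transpose[of _ B] by simp
  have "transpose B *v (B *v ?t)
    = (edge_len z l)\<^sup>2 *\<^sub>R (?t + shear l *\<^sub>R ?n)"
    using frame[of "transpose B *v (B *v ?t)"] unfolding t n by (simp add: scaleR_add_right)
  then show ?thesis
    using edge_len_pos[of l]
    by (simp add: tangent_eq matrix_vector_mult_scaleR power2_eq_square del: transpose_matrix_vector)
qed

lemma PK_inner:
  "v \<bullet> (PK z M (F p) *v w) = (1 / det B) * ((transpose B *v v) \<bullet> (M p *v (transpose B *v w)))"
proof -
  have "v \<bullet> (PK z M (F p) *v w) = (1 / det B) * (v \<bullet> (B *v (M p *v (transpose B *v w))))"
    by (simp add: PK_def scaleR_matrix_vector_assoc[symmetric] matrix_vector_mul_assoc[symmetric]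
        del: transpose_matrix_vector)
  then show ?thesis
    unfolding inner_matrix_transpose[of v B] .
qed

lemma tr_n_PK: "tr_n z l (PK z M) (F p) = det B / (edge_len z l)\<^sup>2 * tr_n ref_vertex l M p"
  using det_pos edge_len_pos[of l]
  by (simp add: tr_n_def PK_inner transpose_B_normal matrix_vector_mult_scaleR power2_eq_square
      del: transpose_matrix_vector)

text \<open>Only the shear term prevents the jumps from being invariant under the transformation.\<close>

lemma tn_comp_PK:
  "tn_comp z l (PK z M) (F p) = tn_comp ref_vertex l M p + shear l * tr_n ref_vertex l M p"
  using det_pos edge_len_pos[of l]
  by (simp add: tn_comp_def tr_n_def PK_inner transpose_B_normal transpose_B_tangent
      matrix_vector_mult_scaleR inner_add_left algebra_simps del: transpose_matrix_vector)

end

section \<open>Transformation of the traces\<close>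

lemma dir_deriv_eq: "(f has_derivative f') (at x) \<Longrightarrow> dir_deriv v f x = f' v"
  by (simp add: dir_deriv_def frechet_derivative_at[symmetric])

lemma row_div_eq:
  assumes "(M has_derivative D) (at x)"
  shows "row_div M x = (\<chi> i. D (axis 1 1) $ i $ 1 + D (axis 2 1) $ i $ 2)"
proof -
  have "dir_deriv v (\<lambda>y. M y $ i $ j) x = D v $ i $ j" for v i j
    by (rule dir_deriv_eq)
       (intro bounded_linear.has_derivative[OF bounded_linear_vec_nth] assms)
  then show ?thesis
    by (simp add: row_div_def sum_2)
qed

lemma bounded_linear_inner_matrix_vector:
  "bounded_linear (\<lambda>X :: real ^ 'n ^ 'm. v \<bullet> (X *v w))"
proof -
  have "linear (\<lambda>X :: real ^ 'n ^ 'm. v \<bullet> (X *v w))"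
    by (rule linearI) (simp_all add: matrix_vector_mult_add_rdistrib inner_add_right
        scaleR_matrix_vector_assoc[symmetric])
  then show ?thesis
    by (rule linear_conv_bounded_linear[THEN iffD1])
qed

lemma bounded_linear_congruence:
  "bounded_linear (\<lambda>X :: real ^ 2 ^ 2. c *\<^sub>R (A ** X ** transpose A))" for A :: "real ^ 2 ^ 2"
proof -
  have "linear (\<lambda>X :: real ^ 2 ^ 2. c *\<^sub>R (A ** X ** transpose A))"
    by (rule linearI) (simp_all add: vec_eq_iff forall_2 matrix_matrix_mult_def sum_2 algebra_simps)
  then show ?thesis
    by (rule linear_conv_bounded_linear[THEN iffD1])
qed

lemma has_integral_affine:
  fixes a p q :: real
  assumes "a > 0"
  shows "((\<lambda>s. p + q * (s / a)) has_integral a * (p + q / 2)) {0..a}"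
proof -
  have "((\<lambda>s. p + q * (s / a)) has_integral
      (p * a + q * a\<^sup>2 / (2 * a)) - (p * 0 + q * 0\<^sup>2 / (2 * a))) {0..a}"
    using assms
    by (intro fundamental_theorem_of_calculus)
       (auto intro!: derivative_eq_intros simp: has_real_derivative_iff_has_vector_derivative[symmetric])
  moreover have "(p * a + q * a\<^sup>2 / (2 * a)) - (p * 0 + q * 0\<^sup>2 / (2 * a)) = a * (p + q / 2)"
    using assms by (simp add: field_simps power2_eq_square)
  ultimately show ?thesis
    by simp
qed

lemma has_integral_affine_moment:
  fixes a p q :: real
  assumes "a > 0"
  shows "((\<lambda>s. (p + q * (s / a)) * (2 * (s / a) - 1)) has_integral a * q / 6) {0..a}"
proof -
  define G where "G s = p * s\<^sup>2 / a - p * s + 2 * q * s ^ 3 / (3 * a\<^sup>2) - q * s\<^sup>2 / (2 * a)" for s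
  have "(G has_real_derivative (p + q * (s / a)) * (2 * (s / a) - 1)) (at s within S)" for s S
    unfolding G_def using assms
    by (auto intro!: derivative_eq_intros simp: field_simps power2_eq_square)
  then have "((\<lambda>s. (p + q * (s / a)) * (2 * (s / a) - 1)) has_integral G a - G 0) {0..a}"
    using assms by (intro fundamental_theorem_of_calculus)
       (auto simp: has_real_derivative_iff_has_vector_derivative[symmetric])
  moreover have "G a - G 0 = a * q / 6"
    using assms by (simp add: G_def field_simps power2_eq_square power3_eq_cube)
  ultimately show ?thesis
    by simp
qed

context parallelogram_element
begin

lemma inv_F_has_derivative:
  obtains C where "C ** B = mat 1" "\<And>x. (inv F has_derivative (\<lambda>h. C *v h)) (at x)"
proof -
  have "invertible B"
    using det_pos by (simp add: invertible_det_nz)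
  then obtain C where C: "C ** B = mat 1"
    by (auto simp: invertible_def)
  have "inv F x = C *v (x - z 1)" for x
  proof -
    have "C *v (F (inv F x) - z 1) = inv F x"
      by (simp add: F_map_def matrix_vector_mul_assoc C)
    then show ?thesis
      by simp
  qed
  then have "inv F = (\<lambda>x. C *v x - C *v z 1)"
    by (simp add: fun_eq_iff matrix_vector_mult_diff_distrib)
  moreover have "((\<lambda>x. C *v x - C *v z 1) has_derivative (\<lambda>h. C *v h)) (at x)" for x
    by (rule has_derivative_eq_rhs,
        rule has_derivative_diff[OF bounded_linear_imp_has_derivative has_derivative_const]) simp_all
  ultimately have "(inv F has_derivative (\<lambda>h. C *v h)) (at x)" for x
    by simp
  with C show ?thesis
    using that by blast
qed

lemma PK_has_derivative:
  assumes "(M has_derivative D) (at p)" "\<And>x. (inv F has_derivative C) (at x)"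
  shows "(PK z M has_derivative (\<lambda>h. (1 / det B) *\<^sub>R (B ** D (C h) ** transpose B))) (at (F p))"
proof -
  have "((\<lambda>x. M (inv F x)) has_derivative (\<lambda>h. D (C h))) (at (F p))"
    using has_derivative_compose[OF assms(2), of M D "F p"] assms(1) by simp
  from bounded_linear.has_derivative[OF bounded_linear_congruence this]
  show ?thesis
    by (simp add: PK_def[abs_def])
qed

text \<open>The Piola identity, for each row: since \<open>B\<close> is constant, the factor \<open>B\<^sup>T\<close> on the right of the
transformed tensor cancels the inverse of \<open>B\<close> that the chain rule produces.\<close>

lemma row_div_PK:
  assumes "M differentiable (at p)"
  shows "row_div (PK z M) (F p) = (1 / det B) *\<^sub>R (B *v row_div M p)"
proof -
  obtain D where D: "(M has_derivative D) (at p)"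
    using assms by (auto simp: differentiable_def)
  obtain C where C: "C ** B = mat 1" "\<And>x. (inv F has_derivative (\<lambda>h. C *v h)) (at x)"
    using inv_F_has_derivative by blast
  \<comment> \<open>The entries of \<open>C B = 1\<close>, to collapse the sums produced by the chain rule.\<close>
  have CB: "C $ 1 $ 1 * B $ 1 $ 1 + C $ 1 $ 2 * B $ 2 $ 1 = 1"
    "C $ 1 $ 1 * B $ 1 $ 2 + C $ 1 $ 2 * B $ 2 $ 2 = 0"
    "C $ 2 $ 1 * B $ 1 $ 1 + C $ 2 $ 2 * B $ 2 $ 1 = 0"
    "C $ 2 $ 1 * B $ 1 $ 2 + C $ 2 $ 2 * B $ 2 $ 2 = 1"
    using C(1) by (simp_all add: vec_eq_iff forall_2 matrix_matrix_mult_def sum_2 mat_def)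
  define X Y where "X = D (axis 1 1)" and "Y = D (axis 2 1)"
  have lin: "linear D"
    using D by (rule has_derivative_linear)
  have C': "D (C *v axis j 1) = C $ 1 $ j *\<^sub>R X + C $ 2 $ j *\<^sub>R Y" for j
  proof -
    have "C *v axis j 1 = C $ 1 $ j *\<^sub>R axis 1 1 + C $ 2 $ j *\<^sub>R axis 2 1"
      using exhaust_2[of j]
      by (auto simp: vec_eq_iff forall_2 matrix_vector_mult_def sum_2 axis_def)
    then show ?thesis
      by (simp add: X_def Y_def linear_add[OF lin] linear_cmul[OF lin])
  qed
  have "(B ** (C $ 1 $ 1 *\<^sub>R X + C $ 2 $ 1 *\<^sub>R Y) ** transpose B) $ i $ 1
      + (B ** (C $ 1 $ 2 *\<^sub>R X + C $ 2 $ 2 *\<^sub>R Y) ** transpose B) $ i $ 2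
      = (B *v (\<chi> i. X $ i $ 1 + Y $ i $ 2)) $ i" for i
  proof -
    have "(B ** (C $ 1 $ 1 *\<^sub>R X + C $ 2 $ 1 *\<^sub>R Y) ** transpose B) $ i $ 1
      + (B ** (C $ 1 $ 2 *\<^sub>R X + C $ 2 $ 2 *\<^sub>R Y) ** transpose B) $ i $ 2
      = (B $ i $ 1 * X $ 1 $ 1 + B $ i $ 2 * X $ 2 $ 1) * (C $ 1 $ 1 * B $ 1 $ 1 + C $ 1 $ 2 * B $ 2 $ 1)
      + (B $ i $ 1 * X $ 1 $ 2 + B $ i $ 2 * X $ 2 $ 2) * (C $ 1 $ 1 * B $ 1 $ 2 + C $ 1 $ 2 * B $ 2 $ 2)
      + (B $ i $ 1 * Y $ 1 $ 1 + B $ i $ 2 * Y $ 2 $ 1) * (C $ 2 $ 1 * B $ 1 $ 1 + C $ 2 $ 2 * B $ 2 $ 1)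
      + (B $ i $ 1 * Y $ 1 $ 2 + B $ i $ 2 * Y $ 2 $ 2) * (C $ 2 $ 1 * B $ 1 $ 2 + C $ 2 $ 2 * B $ 2 $ 2)"
      by (simp add: matrix_matrix_mult_def transpose_def sum_2 algebra_simps)
    then show ?thesis
      unfolding CB by (simp add: matrix_vector_mult_def sum_2 algebra_simps)
  qed
  then show ?thesis
    unfolding row_div_eq[OF PK_has_derivative[OF D C(2)]] row_div_eq[OF D] C'
      X_def[symmetric] Y_def[symmetric]
    by (simp add: vec_eq_iff add_divide_distrib[symmetric])
qed

text \<open>The divergence part is invariant up to the edge length by \<open>row_div_PK\<close>; the shear term is
the tangential derivative of the one in \<open>tn_comp_PK\<close>.\<close>

lemma tr_t_PK:
  assumes "M differentiable (at p)"
  shows "tr_t z l (PK z M) (F p) = (1 / edge_len z l) *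
    (tr_t ref_vertex l M p + shear l * dir_deriv (tangent ref_vertex l) (tr_n ref_vertex l M) p)"
proof -
  obtain D where D: "(M has_derivative D) (at p)"
    using assms by (auto simp: differentiable_def)
  obtain C where C: "C ** B = mat 1" "\<And>x. (inv F has_derivative (\<lambda>h. C *v h)) (at x)"
    using inv_F_has_derivative by blast
  let ?t = "tangent ref_vertex l" and ?n = "normal ref_vertex l"
  have ref: "(tn_comp ref_vertex l M has_derivative (\<lambda>h. ?t \<bullet> (D h *v ?n))) (at p)"
    "(tr_n ref_vertex l M has_derivative (\<lambda>h. ?n \<bullet> (D h *v ?n))) (at p)"
    unfolding tn_comp_def tr_n_def
    by (rule bounded_linear.has_derivative[OF bounded_linear_inner_matrix_vector D])+
  let ?g = "\<lambda>p. tn_comp ref_vertex l M p + shear l * tr_n ref_vertex l M p"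
  let ?g' = "\<lambda>h. ?t \<bullet> (D h *v ?n) + shear l * (?n \<bullet> (D h *v ?n))"
  have "(?g has_derivative ?g') (at p)"
    by (intro derivative_intros ref)
  then have "((\<lambda>x. ?g (inv F x)) has_derivative (\<lambda>h. ?g' (C *v h))) (at (F p))"
    using has_derivative_compose[OF C(2), of ?g ?g' "F p"] by simp
  moreover have "tn_comp z l (PK z M) = (\<lambda>x. ?g (inv F x))"
    using tn_comp_PK[of l M "inv F x" for x] by auto
  ultimately have "dir_deriv (tangent z l) (tn_comp z l (PK z M)) (F p) = ?g' (C *v tangent z l)"
    by (simp add: dir_deriv_eq)
  also have "C *v tangent z l = (1 / edge_len z l) *\<^sub>R ?t"
    by (simp add: tangent_eq matrix_vector_mult_scaleR matrix_vector_mul_assoc C(1))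
  also have "?g' \<dots> = (1 / edge_len z l) * ?g' ?t"
    by (simp add: linear_cmul[OF has_derivative_linear[OF D]] scaleR_matrix_vector_assoc[symmetric]
        algebra_simps)
  finally have *: "dir_deriv (tangent z l) (tn_comp z l (PK z M)) (F p)
      = (1 / edge_len z l) * ?g' ?t" .
  have "normal z l \<bullet> row_div (PK z M) (F p) = (1 / edge_len z l) * (?n \<bullet> row_div M p)"
    using det_pos
    by (simp add: row_div_PK[OF assms] inner_matrix_transpose[of _ B] transpose_B_normal
        del: transpose_matrix_vector)
  with * show ?thesis
    by (simp add: tr_t_def dir_deriv_eq[OF ref(1)] dir_deriv_eq[OF ref(2)] algebra_simps)
qed

lemma edge_parametrization: "z l + s *\<^sub>R tangent z l = F (edge_point l (s / edge_len z l))"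
  by (simp add: edge_point_def F_add_scaleR vertex_eq[symmetric] tangent_eq)

lemma edge_legendre_F: "edge_legendre z l m (F (edge_point l s)) = legendre m (2 * s - 1)"
proof -
  have "F (edge_point l s) - z l = s *\<^sub>R (B *v tangent ref_vertex l)"
    by (simp add: edge_point_def F_add_scaleR vertex_eq[symmetric])
  moreover have "(B *v tangent ref_vertex l) \<bullet> tangent z l = edge_len z l"
    using edge_len_pos[of l]
    by (simp add: tangent_eq edge_len_eq power2_norm_eq_inner[symmetric] power2_eq_square)
  ultimately show ?thesis
    using edge_len_pos[of l] by (simp add: edge_legendre_def)
qed

lemma edge_inner_affine:
  assumes "\<And>s. f (F (edge_point l s)) = p + q * s"
  shows "edge_inner z l f (edge_legendre z l 0) = edge_len z l * (p + q / 2)"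
    and "edge_inner z l f (edge_legendre z l 1) = edge_len z l * q / 6"
  using has_integral_affine[OF edge_len_pos, THEN integral_unique]
    has_integral_affine_moment[OF edge_len_pos, THEN integral_unique]
  by (simp_all add: edge_inner_def edge_parametrization edge_legendre_F assms)

lemma edge_norm_legendre:
  "(edge_norm z l (edge_legendre z l 0))\<^sup>2 = edge_len z l"
  "(edge_norm z l (edge_legendre z l 1))\<^sup>2 = edge_len z l / 3"
proof -
  have "edge_inner z l (edge_legendre z l 0) (edge_legendre z l 0) = edge_len z l"
    by (subst edge_inner_affine(1)[where p = 1 and q = 0]) (simp_all add: edge_legendre_F)
  moreover have "edge_inner z l (edge_legendre z l 1) (edge_legendre z l 1) = edge_len z l / 3"
    by (subst edge_inner_affine(2)[where p = "-1" and q = 2]) (simp_all add: edge_legendre_F)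
  ultimately show "(edge_norm z l (edge_legendre z l 0))\<^sup>2 = edge_len z l"
    "(edge_norm z l (edge_legendre z l 1))\<^sup>2 = edge_len z l / 3"
    using edge_len_pos[of l] by (simp_all add: edge_norm_def)
qed

text \<open>In the space considered here, all traces that enter the degrees of freedom are affine along the
edges, so that two numbers per edge determine the moments with the Legendre polynomials. The squared
norm \<open>e\<^sub>l / 3\<close> of the linear one turns \<open>q / 6\<close> into \<open>q / 2\<close>.\<close>

lemma dof_n_affine:
  assumes "\<And>s. tr_n z l M (F (edge_point l s)) = p + q * s"
  shows "dof_n z l 0 M = p + q / 2" and "dof_n z l 1 M = q / 2"
  using edge_len_pos[of l]
  by (simp_all only: dof_n_def edge_inner_affine[OF assms] edge_norm_legendre) simp_all

lemma dof_t_affine: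
  assumes "\<And>s. tr_t z l M (F (edge_point l s)) = p + q * s"
  shows "dof_t z l 0 M = edge_len z l * (p + q / 2)" and "dof_t z l 1 M = edge_len z l * q / 6"
  by (simp_all only: dof_t_def edge_inner_affine[OF assms])

end

section \<open>Coordinates on the reference space\<close>

text \<open>Coordinates on the pulled-back space, grouped as the coefficients \<open>a\<close>, \<open>b\<close>, \<open>c\<close> that belong to
the entries 11, 12, 22, and the coefficients \<open>d\<close> of the cubic fields in which these entries are
coupled. A Euclidean type of dimension 20 provides linear algebra and compactness at once.\<close>

type_synonym coeffs =
  "(real \<times> real \<times> real \<times> real \<times> real) \<times>
   (real \<times> real \<times> real \<times> real \<times> real \<times> real) \<times>
   (real \<times> real \<times> real \<times> real \<times> real) \<times> (real \<times> real \<times> real \<times> real)"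

text \<open>The coupling of the cubic terms reflects that the quadratic part of a Raviart--Thomas field is
\<open>q(x) x\<close> with one and the same linear form \<open>q\<close> in both components.\<close>

fun hat_field :: "coeffs \<Rightarrow> tensor_field" where
  "hat_field ((a0, a1, a2, a3, a4), (b0, b1, b2, b3, b4, b5), (c0, c1, c2, c3, c4),
      (d1, d2, d3, d4)) p = (let x = p $ 1; y = p $ 2 in
     sym_mat
       (a0 + a1 * x + a2 * y + a3 * x\<^sup>2 + a4 * x * y + d1 * x ^ 3 + d2 * x\<^sup>2 * y)
       (b0 + b1 * x + b2 * y + b3 * x\<^sup>2 + b4 * x * y + b5 * y\<^sup>2
          + (d1 + d3) / 2 * x\<^sup>2 * y + (d2 + d4) / 2 * x * y\<^sup>2)
       (c0 + c1 * x + c2 * y + c3 * x * y + c4 * y\<^sup>2 + d3 * x * y\<^sup>2 + d4 * y ^ 3))"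

lemma coeffs_cases:
  fixes c :: coeffs
  obtains a0 a1 a2 a3 a4 b0 b1 b2 b3 b4 b5 c0 c1 c2 c3 c4 d1 d2 d3 d4 where
    "c = ((a0, a1, a2, a3, a4), (b0, b1, b2, b3, b4, b5), (c0, c1, c2, c3, c4), (d1, d2, d3, d4))"
  by (metis surj_pair)

lemma linear_hat_field: "linear hat_field"
proof (rule linearI)
  fix c c' :: coeffs and r :: real
  show "hat_field (c + c') = hat_field c + hat_field c'"
    by (cases c rule: coeffs_cases, cases c' rule: coeffs_cases)
       (simp add: fun_eq_iff Let_def sym_mat_def vec_eq_iff forall_2 algebra_simps add_divide_distrib)
  show "hat_field (r *\<^sub>R c) = r *\<^sub>R hat_field c"
    by (cases c rule: coeffs_cases)
       (simp add: fun_eq_iff scaleR_fun_def Let_def sym_mat_def vec_eq_iff forall_2 algebra_simps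
          add_divide_distrib)
qed

lemma sym_mat_has_derivative:
  assumes "(f has_derivative f') F" "(g has_derivative g') F" "(h has_derivative h') F"
  shows "((\<lambda>p. sym_mat (f p) (g p) (h p)) has_derivative (\<lambda>v. sym_mat (f' v) (g' v) (h' v))) F"
proof -
  have eq: "sym_mat a b c = a *\<^sub>R sym_mat 1 0 0 + b *\<^sub>R sym_mat 0 1 0 + c *\<^sub>R sym_mat 0 0 1"
    for a b c
    by (simp add: sym_mat_def vec_eq_iff forall_2)
  have "((\<lambda>p. f p *\<^sub>R X + g p *\<^sub>R Y + h p *\<^sub>R Z) has_derivative
      (\<lambda>v. f' v *\<^sub>R X + g' v *\<^sub>R Y + h' v *\<^sub>R Z)) F" for X Y Z :: "real ^ 2 ^ 2"
    by (intro has_derivative_add has_derivative_scaleR_left assms)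
  from this[of "sym_mat 1 0 0" "sym_mat 0 1 0" "sym_mat 0 0 1"] show ?thesis
    unfolding eq[symmetric] .
qed

lemma hat_field_has_derivative:
  assumes c: "c = ((a0, a1, a2, a3, a4), (b0, b1, b2, b3, b4, b5), (c0, c1, c2, c3, c4),
      (d1, d2, d3, d4))"
  shows "(hat_field c has_derivative (\<lambda>v. sym_mat
       (v $ 1 * (a1 + 2 * a3 * p $ 1 + a4 * p $ 2 + 3 * d1 * (p $ 1)\<^sup>2 + 2 * d2 * p $ 1 * p $ 2)
         + v $ 2 * (a2 + a4 * p $ 1 + d2 * (p $ 1)\<^sup>2))
       (v $ 1 * (b1 + 2 * b3 * p $ 1 + b4 * p $ 2 + (d1 + d3) * p $ 1 * p $ 2
             + (d2 + d4) / 2 * (p $ 2)\<^sup>2)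
         + v $ 2 * (b2 + b4 * p $ 1 + 2 * b5 * p $ 2 + (d1 + d3) / 2 * (p $ 1)\<^sup>2
             + (d2 + d4) * p $ 1 * p $ 2))
       (v $ 1 * (c1 + c3 * p $ 2 + d3 * (p $ 2)\<^sup>2)
         + v $ 2 * (c2 + c3 * p $ 1 + 2 * c4 * p $ 2 + 2 * d3 * p $ 1 * p $ 2 + 3 * d4 * (p $ 2)\<^sup>2))))
     (at p)"
proof -
  have x: "((\<lambda>p :: point. p $ i) has_derivative (\<lambda>v. v $ i)) (at p)" for i
    by (rule bounded_linear_imp_has_derivative[OF bounded_linear_vec_nth])
  have eq: "hat_field c = (\<lambda>p. sym_mat
      (a0 + a1 * p $ 1 + a2 * p $ 2 + a3 * (p $ 1)\<^sup>2 + a4 * p $ 1 * p $ 2 + d1 * (p $ 1) ^ 3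
        + d2 * (p $ 1)\<^sup>2 * p $ 2)
      (b0 + b1 * p $ 1 + b2 * p $ 2 + b3 * (p $ 1)\<^sup>2 + b4 * p $ 1 * p $ 2 + b5 * (p $ 2)\<^sup>2
        + (d1 + d3) / 2 * (p $ 1)\<^sup>2 * p $ 2 + (d2 + d4) / 2 * p $ 1 * (p $ 2)\<^sup>2)
      (c0 + c1 * p $ 1 + c2 * p $ 2 + c3 * p $ 1 * p $ 2 + c4 * (p $ 2)\<^sup>2
        + d3 * p $ 1 * (p $ 2)\<^sup>2 + d4 * (p $ 2) ^ 3))"
    by (rule ext) (simp add: c Let_def)
  note rules = has_derivative_add has_derivative_mult has_derivative_power has_derivative_const x
  show ?thesis
    unfolding eq
  proof (rule sym_mat_has_derivative, goal_cases)
    case 1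
    show ?case
      by (rule has_derivative_eq_rhs, (rule rules)+)
         (simp add: fun_eq_iff algebra_simps power2_eq_square)
  next
    case 2
    show ?case
      by (rule has_derivative_eq_rhs, (rule rules)+)
         (simp add: fun_eq_iff field_simps power2_eq_square)
  next
    case 3
    show ?case
      by (rule has_derivative_eq_rhs, (rule rules)+)
         (simp add: fun_eq_iff algebra_simps power2_eq_square)
  qed
qed

lemma hat_field_differentiable: "hat_field c differentiable (at p)"
proof (cases c rule: coeffs_cases)
  case 1
  from hat_field_has_derivative[OF this] show ?thesis
    by (rule differentiableI)
qed

lemma sym_mat_nth [simp]:
  "sym_mat a b c $ 1 $ 1 = a" "sym_mat a b c $ 1 $ 2 = b"
  "sym_mat a b c $ 2 $ 1 = b" "sym_mat a b c $ 2 $ 2 = c"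
  by (simp_all add: sym_mat_def)

lemma tr_n_ref:
  "tr_n ref_vertex l M p = (if l = 1 \<or> l = 3 then M p $ 2 $ 2 else M p $ 1 $ 1)"
  by (cases l rule: exhaust_four)
     (simp_all add: tr_n_def normal_ref inner_vec_def sum_2 matrix_vector_mult_def)

lemma tn_comp_ref_hat_field:
  "tn_comp ref_vertex l (hat_field c) p = (if l = 1 \<or> l = 3 then - 1 else 1) * hat_field c p $ 1 $ 2"
  by (cases c rule: coeffs_cases; cases l rule: exhaust_four)
     (simp_all add: tn_comp_def tangent_ref normal_ref inner_vec_def sum_2 matrix_vector_mult_def
       Let_def)

lemma tr_t_ref:
  assumes "(M has_derivative D) (at p)"
  shows "tr_t ref_vertex l M p
    = normal ref_vertex l \<bullet> (\<chi> i. D (axis 1 1) $ i $ 1 + D (axis 2 1) $ i $ 2)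
      + tangent ref_vertex l \<bullet> (D (tangent ref_vertex l) *v normal ref_vertex l)"
proof -
  have "(tn_comp ref_vertex l M has_derivative
      (\<lambda>h. tangent ref_vertex l \<bullet> (D h *v normal ref_vertex l))) (at p)"
    unfolding tn_comp_def
    by (rule bounded_linear.has_derivative[OF bounded_linear_inner_matrix_vector assms])
  then show ?thesis
    by (simp add: tr_t_def row_div_eq[OF assms] dir_deriv_eq)
qed

lemma tr_t_ref_hat_field:
  assumes c: "c = ((a0, a1, a2, a3, a4), (b0, b1, b2, b3, b4, b5), (c0, c1, c2, c3, c4),
      (d1, d2, d3, d4))"
  shows "tr_t ref_vertex l (hat_field c) p = (if l = 1 \<or> l = 4 then - 1 else 1) *
    (if l = 1 \<or> l = 3 then
       2 * (b1 + 2 * b3 * p $ 1 + b4 * p $ 2 + (d1 + d3) * p $ 1 * p $ 2 + (d2 + d4) / 2 * (p $ 2)\<^sup>2)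
       + (c2 + c3 * p $ 1 + 2 * c4 * p $ 2 + 2 * d3 * p $ 1 * p $ 2 + 3 * d4 * (p $ 2)\<^sup>2)
     else
       (a1 + 2 * a3 * p $ 1 + a4 * p $ 2 + 3 * d1 * (p $ 1)\<^sup>2 + 2 * d2 * p $ 1 * p $ 2)
       + 2 * (b2 + b4 * p $ 1 + 2 * b5 * p $ 2 + (d1 + d3) / 2 * (p $ 1)\<^sup>2 + (d2 + d4) * p $ 1 * p $ 2))"
  by (cases l rule: exhaust_four)
     (simp_all add: tr_t_ref[OF hat_field_has_derivative[OF c]] tangent_ref normal_ref inner_vec_def
       sum_2 matrix_vector_mult_def axis_def)

lemma edge_point_nth:
  "edge_point l s $ 1 = (if l = 1 then s else if l = 2 then 1 else if l = 3 then 1 - s else 0)"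
  "edge_point l s $ 2 = (if l = 1 then 0 else if l = 2 then s else if l = 3 then 1 else 1 - s)"
  by (cases l rule: exhaust_four; simp add: edge_point_def tangent_ref)+

text \<open>Although the entries are cubic, the normal-normal trace is affine on each edge: the entry 22
has degree one in \<open>x\<close>, and the entry 11 has degree one in \<open>y\<close>.\<close>

lemma tr_n_hat_field_edge:
  "tr_n ref_vertex l (hat_field c) (edge_point l s) = tr_n ref_vertex l (hat_field c) (ref_vertex l)
    + (tr_n ref_vertex l (hat_field c) (ref_vertex (l + 1))
       - tr_n ref_vertex l (hat_field c) (ref_vertex l)) * s"
  by (cases c rule: coeffs_cases; cases l rule: exhaust_four)
     (simp_all add: tr_n_ref edge_point_nth cyclic_five Let_def algebra_simps)

text \<open>In the divergence and in the tangential derivative, every cubic term of the entries contributes a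
polynomial of degree at most one in the edge parameter.\<close>

lemma tr_t_hat_field_edge:
  "tr_t ref_vertex l (hat_field c) (edge_point l s) = tr_t ref_vertex l (hat_field c) (ref_vertex l)
    + (tr_t ref_vertex l (hat_field c) (ref_vertex (l + 1))
       - tr_t ref_vertex l (hat_field c) (ref_vertex l)) * s"
  by (cases c rule: coeffs_cases; cases l rule: exhaust_four)
     (simp_all add: tr_t_ref_hat_field edge_point_nth cyclic_five algebra_simps)

text \<open>A directional derivative sees only the values on the line in that direction.\<close>

lemma dir_deriv_affine:
  assumes "f differentiable (at (x + s *\<^sub>R v))" "\<And>s. f (x + s *\<^sub>R v) = p + q * s"
  shows "dir_deriv v f (x + s *\<^sub>R v) = q"
proof -
  obtain f' where f': "(f has_derivative f') (at (x + s *\<^sub>R v))"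
    using assms(1) by (auto simp: differentiable_def)
  have "((\<lambda>s. x + s *\<^sub>R v) has_derivative (\<lambda>h. h *\<^sub>R v)) (at s)"
    by (auto intro!: derivative_eq_intros)
  from has_derivative_compose[OF this f']
  have "((\<lambda>s. p + q * s) has_derivative (\<lambda>h. f' (h *\<^sub>R v))) (at s)"
    by (simp add: assms(2))
  moreover have "((\<lambda>s. p + q * s) has_derivative (\<lambda>h. q * h)) (at s)"
    by (auto intro!: derivative_eq_intros)
  ultimately have "(\<lambda>h. f' (h *\<^sub>R v)) = (\<lambda>h. q * h)"
    by (rule has_derivative_unique)
  then show ?thesis
    using dir_deriv_eq[OF f'] by (metis mult.right_neutral scaleR_one)
qed

lemma dir_deriv_tr_n_hat_field:
  "dir_deriv (tangent ref_vertex l) (tr_n ref_vertex l (hat_field c)) (edge_point l s)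
    = tr_n ref_vertex l (hat_field c) (ref_vertex (l + 1))
      - tr_n ref_vertex l (hat_field c) (ref_vertex l)"
proof -
  have "tr_n ref_vertex l (hat_field c) differentiable (at x)" for x
    using hat_field_differentiable[of c x] unfolding tr_n_def differentiable_def
    by (blast intro: bounded_linear.has_derivative[OF bounded_linear_inner_matrix_vector])
  then show ?thesis
    using dir_deriv_affine tr_n_hat_field_edge unfolding edge_point_def by blast
qed

section \<open>Traces of the reference tensors\<close>

text \<open>The coordinates of the reference tensors, found by expanding the given polynomials.\<close>

definition T_coeffs :: "4 \<Rightarrow> nat \<Rightarrow> coeffs" where
  "T_coeffs j k =
     (if k = 0 then
        if j = 1 then
          ((0, 1/4, 0, - 1/4, - 1/2), (0, 0, - 1/8, 0, 1/4, 1/8),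
           (0, 0, - 1, 0, 2), (0, 1/2, 0, - 1))
        else if j = 2 then
          ((0, 0, 0, - 1, 0), (0, 1/8, 0, - 1/8, - 1/4, 0),
           (0, 0, - 1/4, 1/2, 1/4), (1, 0, - 1/2, 0))
        else if j = 3 then
          ((0, - 1/4, 0, 1/4, 1/2), (0, 0, 1/8, 0, - 1/4, - 1/8),
           (0, 0, 0, 0, - 1), (0, - 1/2, 0, 1))
        else
          ((0, - 1, 0, 2, 0), (0, - 1/8, 0, 1/8, 1/4, 0),
           (0, 0, 1/4, - 1/2, - 1/4), (- 1, 0, 1/2, 0))
      else
        if j = 1 then
          ((0, 0, 0, 0, 0), (0, 9/8, 0, - 9/8, - 3/4, 0),
           (0, 0, 3/4, - 3/2, - 3/4), (0, 0, 3/2, 0))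
        else if j = 2 then
          ((0, 3/4, 0, - 3/4, - 3/2), (0, 0, - 3/8, 0, - 3/4, 3/8),
           (0, 0, 0, 0, 0), (0, 3/2, 0, 0))
        else if j = 3 then
          ((0, 0, 0, 0, 0), (0, 3/8, 0, - 3/8, 3/4, 0),
           (0, 0, - 3/4, 3/2, 3/4), (0, 0, - 3/2, 0))
        else
          ((0, - 3/4, 0, 3/4, 3/2), (0, 0, - 9/8, 0, 3/4, 9/8),
           (0, 0, 0, 0, 0), (0, - 3/2, 0, 0)))"

definition J_tilde_coeffs :: "4 \<Rightarrow> coeffs" where
  "J_tilde_coeffs j = (0, (if j = 1 then (1/2, - 1/2, - 1/2, 0, 1/2, 0)
      else if j = 2 then (0, - 1/2, 0, 0, 1/2, 0)
      else if j = 3 then (0, 0, 0, 0, 1/2, 0) else (0, 0, - 1/2, 0, 1/2, 0)), 0, 0)"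

definition N_tilde_coeffs :: "4 \<Rightarrow> nat \<Rightarrow> coeffs" where
  "N_tilde_coeffs j k =
     (if j = 1 then (0, 0, (if k = 0 then (1, 0, - 1, 0, 0) else (- 1, 2, 1, - 2, 0)), 0)
      else if j = 2 then ((if k = 0 then (0, 1, 0, 0, 0) else (0, - 1, 0, 0, 2)), 0, 0, 0)
      else if j = 3 then (0, 0, (if k = 0 then (0, 0, 1, 0, 0) else (0, 0, 1, - 2, 0)), 0)
      else ((if k = 0 then (1, - 1, 0, 0, 0) else (1, - 1, - 2, 0, 2)), 0, 0, 0))"

lemma T_hat_eq: "T_hat j k = hat_field (T_coeffs j k)"
  by (cases j rule: exhaust_four)
     (simp_all add: fun_eq_iff T_hat_def T_coeffs_def Let_def sym_mat_def vec_eq_iff forall_2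
        field_simps power2_eq_square power3_eq_cube)

lemma J_tilde_hat_eq: "J_tilde_hat j = hat_field (J_tilde_coeffs j)"
  by (cases j rule: exhaust_four)
     (simp_all add: fun_eq_iff J_tilde_hat_def J_tilde_coeffs_def Let_def sym_mat_def sym_part_def
        outer_def tangent_ref eta_hat_def transpose_def vec_eq_iff forall_2 zero_prod_def algebra_simps)

lemma N_tilde_coeffs_eq:
  "hat_field (N_tilde_coeffs j k) p
   = (if k = 0 then eta_hat j p + eta_hat (j + 1) p else eta_hat (j + 1) p - eta_hat j p)
     *\<^sub>R outer (tangent ref_vertex (j + 1)) (tangent ref_vertex (j + 1))"
  by (cases j rule: exhaust_four)
     (simp_all add: N_tilde_coeffs_def Let_def sym_mat_def outer_def tangent_ref eta_hat_def
        vec_eq_iff forall_2 zero_prod_def cyclic_five algebra_simps)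

text \<open>On \<open>E\<^sub>j\<close> the trace \<open>tr\<^sub>t\<close> is 1 or three times the linear Legendre polynomial, recorded by
its values at the two end points; the factor 3 compensates its squared norm 1/3.\<close>

lemma T_coeffs_traces:
  "tr_n ref_vertex l (hat_field (T_coeffs j k)) (ref_vertex l) = 0"
  "tr_n ref_vertex l (hat_field (T_coeffs j k)) (ref_vertex (l + 1)) = 0"
  "tn_comp ref_vertex l (hat_field (T_coeffs j k)) (ref_vertex i) = 0"
  "tr_t ref_vertex l (hat_field (T_coeffs j k)) (ref_vertex l)
     = (if l = j then if k = 0 then 1 else - 3 else 0)"
  "tr_t ref_vertex l (hat_field (T_coeffs j k)) (ref_vertex (l + 1))
     = (if l = j then if k = 0 then 1 else 3 else 0)"
proof -
  show "tn_comp ref_vertex l (hat_field (T_coeffs j k)) (ref_vertex i) = 0"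
    by (cases j rule: exhaust_four; cases i rule: exhaust_four)
       (simp_all add: tn_comp_ref_hat_field T_coeffs_def Let_def)
qed (cases j rule: exhaust_four; cases l rule: exhaust_four;
      simp add: tr_n_ref T_coeffs_def Let_def tr_t_ref_hat_field[OF refl] cyclic_five)+

text \<open>The last identity says that \<open>tr\<^sub>t\<close> is constant on every edge. For this reason the
moments with constants are the only ones to be corrected in \<open>J_hat\<close>.\<close>

lemma J_tilde_coeffs_traces:
  "tr_n ref_vertex l (hat_field (J_tilde_coeffs j)) p = 0"
  "tn_comp ref_vertex (l - 1) (hat_field (J_tilde_coeffs j)) (ref_vertex l)
   - tn_comp ref_vertex l (hat_field (J_tilde_coeffs j)) (ref_vertex l) = (if l = j then 1 else 0)"
  "tr_t ref_vertex l (hat_field (J_tilde_coeffs j)) (ref_vertex (l + 1))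
   = tr_t ref_vertex l (hat_field (J_tilde_coeffs j)) (ref_vertex l)"
  by (cases j rule: exhaust_four; cases l rule: exhaust_four;
      simp add: tr_n_ref tn_comp_ref_hat_field J_tilde_coeffs_def Let_def zero_prod_def
        tr_t_ref_hat_field[OF refl] cyclic_five)+

lemma N_tilde_coeffs_traces:
  "tr_n ref_vertex l (hat_field (N_tilde_coeffs j k)) (ref_vertex l)
     = (if l = j then if k = 0 then 1 else - 1 else 0)"
  "tr_n ref_vertex l (hat_field (N_tilde_coeffs j k)) (ref_vertex (l + 1))
     = (if l = j then 1 else 0)"
  by (cases j rule: exhaust_four; cases l rule: exhaust_four;
      simp add: tr_n_ref N_tilde_coeffs_def Let_def zero_prod_def cyclic_five)+

lemma linear_tr_n_hat_field: "linear (\<lambda>c. tr_n ref_vertex l (hat_field c) p)"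
  by (rule linearI)
     (simp_all add: tr_n_ref linear_add[OF linear_hat_field] linear_cmul[OF linear_hat_field]
       scaleR_fun_def)

lemma linear_tn_comp_hat_field: "linear (\<lambda>c. tn_comp ref_vertex l (hat_field c) p)"
  unfolding tn_comp_ref_hat_field
  by (rule linearI)
     (simp_all add: linear_add[OF linear_hat_field] linear_cmul[OF linear_hat_field] scaleR_fun_def)

lemma linear_tr_t_hat_field: "linear (\<lambda>c. tr_t ref_vertex l (hat_field c) p)"
proof (rule linearI)
  fix c c' :: coeffs and r :: real
  show "tr_t ref_vertex l (hat_field (c + c')) p
      = tr_t ref_vertex l (hat_field c) p + tr_t ref_vertex l (hat_field c') p"
    by (cases c rule: coeffs_cases; cases c' rule: coeffs_cases; cases l rule: exhaust_four)
       (simp_all add: tr_t_ref_hat_field[OF refl] algebra_simps add_divide_distrib)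
  show "tr_t ref_vertex l (hat_field (r *\<^sub>R c)) p = r *\<^sub>R tr_t ref_vertex l (hat_field c) p"
    by (cases c rule: coeffs_cases; cases l rule: exhaust_four)
       (simp_all add: tr_t_ref_hat_field[OF refl] algebra_simps add_divide_distrib)
qed

lemmas linear_traces = linear_tr_n_hat_field linear_tn_comp_hat_field linear_tr_t_hat_field

definition J_coeffs :: "4 \<Rightarrow> coeffs" where
  "J_coeffs j = J_tilde_coeffs j -
     (\<Sum>l\<in>UNIV. edge_inner ref_vertex l (tr_t ref_vertex l (J_tilde_hat j)) (\<lambda>_. 1) *\<^sub>R T_coeffs l 0)"

lemma J_hat_eq: "J_hat j = hat_field (J_coeffs j)"
  by (simp add: J_hat_def J_coeffs_def linear_diff[OF linear_hat_field]
      linear_sum[OF linear_hat_field] linear_cmul[OF linear_hat_field] T_hat_eq J_tilde_hat_eq)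

lemma edge_inner_J_tilde:
  "edge_inner ref_vertex l (tr_t ref_vertex l (J_tilde_hat j)) (\<lambda>_. 1)
    = tr_t ref_vertex l (hat_field (J_tilde_coeffs j)) (ref_vertex l)"
proof -
  have "tr_t ref_vertex l (J_tilde_hat j) (ref_vertex l + s *\<^sub>R tangent ref_vertex l)
      = tr_t ref_vertex l (hat_field (J_tilde_coeffs j)) (ref_vertex l)" for s
    using tr_t_hat_field_edge[of l "J_tilde_coeffs j" s]
    by (simp add: J_tilde_hat_eq J_tilde_coeffs_traces edge_point_def)
  then show ?thesis
    by (simp add: edge_inner_def)
qed

lemma J_coeffs_functional:
  assumes "linear f"
  shows "f (J_coeffs j) = f (J_tilde_coeffs j)
    - (\<Sum>l\<in>UNIV. tr_t ref_vertex l (hat_field (J_tilde_coeffs j)) (ref_vertex l) *\<^sub>R f (T_coeffs l 0))"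
  by (simp add: J_coeffs_def edge_inner_J_tilde linear_diff[OF assms] linear_sum[OF assms]
      linear_cmul[OF assms])

text \<open>On each edge, the multiple of \<open>T_hat l 0\<close> that is subtracted has the same constant trace \<open>tr\<^sub>t\<close>.
At the vertices it affects neither the normal-normal nor the tangential-normal components.\<close>

lemma J_coeffs_traces:
  "tr_n ref_vertex l (hat_field (J_coeffs j)) (ref_vertex l) = 0"
  "tr_n ref_vertex l (hat_field (J_coeffs j)) (ref_vertex (l + 1)) = 0"
  "tr_t ref_vertex l (hat_field (J_coeffs j)) (ref_vertex l) = 0"
  "tr_t ref_vertex l (hat_field (J_coeffs j)) (ref_vertex (l + 1)) = 0"
  "tn_comp ref_vertex (l - 1) (hat_field (J_coeffs j)) (ref_vertex l)
   - tn_comp ref_vertex l (hat_field (J_coeffs j)) (ref_vertex l) = (if l = j then 1 else 0)"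
proof -
  have "(\<Sum>i\<in>UNIV. a i * (if l = i then 1 else 0)) = a l" for a :: "4 \<Rightarrow> real"
    by (simp add: if_distrib cong: if_cong)
  then show "tr_n ref_vertex l (hat_field (J_coeffs j)) (ref_vertex l) = 0"
    "tr_n ref_vertex l (hat_field (J_coeffs j)) (ref_vertex (l + 1)) = 0"
    "tr_t ref_vertex l (hat_field (J_coeffs j)) (ref_vertex l) = 0"
    "tr_t ref_vertex l (hat_field (J_coeffs j)) (ref_vertex (l + 1)) = 0"
    by (simp_all add: J_coeffs_functional[OF linear_tr_n_hat_field]
        J_coeffs_functional[OF linear_tr_t_hat_field] T_coeffs_traces J_tilde_coeffs_traces)
  show "tn_comp ref_vertex (l - 1) (hat_field (J_coeffs j)) (ref_vertex l)
   - tn_comp ref_vertex l (hat_field (J_coeffs j)) (ref_vertex l) = (if l = j then 1 else 0)"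
    using J_tilde_coeffs_traces(2)[of l j]
    by (simp add: J_coeffs_functional[OF linear_tn_comp_hat_field] T_coeffs_traces)
qed

section \<open>Duality\<close>

lemma outer_matrix_vector: "outer (A *v v) (A *v w) = A ** outer v w ** transpose A"
  by (simp add: outer_def vec_eq_iff forall_2 matrix_vector_mult_def matrix_matrix_mult_def sum_2
      transpose_def algebra_simps)

lemma linear_PK: "linear (PK z)"
proof (rule linearI)
  interpret congr: bounded_linear
    "\<lambda>X. (1 / det (B_mat z)) *\<^sub>R (B_mat z ** X ** transpose (B_mat z))"
    by (rule bounded_linear_congruence)
  fix M N :: tensor_field and r :: real
  show "PK z (M + N) = PK z M + PK z N"
    by (simp add: fun_eq_iff PK_def congr.add)
  show "PK z (r *\<^sub>R M) = r *\<^sub>R PK z M"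
    unfolding fun_eq_iff PK_def scaleR_fun_def by (simp only: congr.scaleR simp_thms)
qed

context parallelogram_element
begin

definition piola :: "coeffs \<Rightarrow> tensor_field" where
  "piola c = PK z (hat_field c)"

lemma linear_piola: "linear piola"
  unfolding piola_def using linear_compose[OF linear_hat_field linear_PK] by (simp add: o_def)

lemma dof_n_piola:
  "dof_n z l 0 (piola c) = det B / (edge_len z l)\<^sup>2 *
     ((tr_n ref_vertex l (hat_field c) (ref_vertex l)
       + tr_n ref_vertex l (hat_field c) (ref_vertex (l + 1))) / 2)"
  "dof_n z l 1 (piola c) = det B / (edge_len z l)\<^sup>2 *
     ((tr_n ref_vertex l (hat_field c) (ref_vertex (l + 1))
       - tr_n ref_vertex l (hat_field c) (ref_vertex l)) / 2)"
proof -
  let ?a = "det B / (edge_len z l)\<^sup>2" and ?n = "tr_n ref_vertex l (hat_field c)"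
  have *: "tr_n z l (piola c) (F (edge_point l s))
      = ?a * ?n (ref_vertex l) + (?a * (?n (ref_vertex (l + 1)) - ?n (ref_vertex l))) * s" for s
    unfolding piola_def tr_n_PK tr_n_hat_field_edge[of l c s] by (simp only: distrib_left mult.assoc)
  show "dof_n z l 0 (piola c) = ?a * ((?n (ref_vertex l) + ?n (ref_vertex (l + 1))) / 2)"
    unfolding dof_n_affine(1)[OF *] mult.assoc[symmetric]
    by (simp only: add_divide_distrib diff_divide_distrib right_diff_distrib distrib_left
        times_divide_eq_right) simp
  show "dof_n z l 1 (piola c) = ?a * ((?n (ref_vertex (l + 1)) - ?n (ref_vertex l)) / 2)"
    unfolding dof_n_affine(2)[OF *] by simp
qed

text \<open>The normal-normal trace is affine on the edge, so that the shear term is constant there and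
enters the mean only.\<close>

lemma dof_t_piola:
  "dof_t z l 0 (piola c) =
     (tr_t ref_vertex l (hat_field c) (ref_vertex l)
       + tr_t ref_vertex l (hat_field c) (ref_vertex (l + 1))) / 2
     + shear l * (tr_n ref_vertex l (hat_field c) (ref_vertex (l + 1))
         - tr_n ref_vertex l (hat_field c) (ref_vertex l))"
  "dof_t z l 1 (piola c) =
     (tr_t ref_vertex l (hat_field c) (ref_vertex (l + 1))
       - tr_t ref_vertex l (hat_field c) (ref_vertex l)) / 6"
proof -
  let ?n = "tr_n ref_vertex l (hat_field c)" and ?t = "tr_t ref_vertex l (hat_field c)"
  let ?d = "shear l * (?n (ref_vertex (l + 1)) - ?n (ref_vertex l))"
  have *: "tr_t z l (piola c) (F (edge_point l s))
      = (?t (ref_vertex l) + ?d) / edge_len z l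
        + ((?t (ref_vertex (l + 1)) - ?t (ref_vertex l)) / edge_len z l) * s" for s
    unfolding piola_def tr_t_PK[OF hat_field_differentiable] dir_deriv_tr_n_hat_field
      tr_t_hat_field_edge[of l c s] using edge_len_pos[of l] by (simp add: field_simps)
  show "dof_t z l 0 (piola c) = (?t (ref_vertex l) + ?t (ref_vertex (l + 1))) / 2 + ?d"
    unfolding dof_t_affine(1)[OF *] using edge_len_pos[of l] by (simp add: field_simps)
  show "dof_t z l 1 (piola c) = (?t (ref_vertex (l + 1)) - ?t (ref_vertex l)) / 6"
    unfolding dof_t_affine(2)[OF *] using edge_len_pos[of l] by (simp add: field_simps)
qed

lemma jump_piola:
  "jump z l (piola c) =
     tn_comp ref_vertex (l - 1) (hat_field c) (ref_vertex l)
     - tn_comp ref_vertex l (hat_field c) (ref_vertex l)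
     + shear (l - 1) * tr_n ref_vertex (l - 1) (hat_field c) (ref_vertex l)
     - shear l * tr_n ref_vertex l (hat_field c) (ref_vertex l)"
proof -
  have "tn_comp z i (piola c) (z l) = tn_comp ref_vertex i (hat_field c) (ref_vertex l)
     + shear i * tr_n ref_vertex i (hat_field c) (ref_vertex l)" for i
    using tn_comp_PK[of i "hat_field c" "ref_vertex l"] by (simp add: piola_def vertex_eq[symmetric])
  then show ?thesis
    by (simp add: jump_def)
qed

lemma linear_dof:
  assumes "m \<in> {0, 1 :: nat}"
  shows "linear (\<lambda>c. dof_n z l m (piola c))" "linear (\<lambda>c. dof_t z l m (piola c))"
  using assms unfolding insert_iff empty_iff
  by (elim disjE FalseE; simp only: dof_n_piola dof_t_piola;
      intro linearI; simp only: linear_traces[THEN linear_add] linear_traces[THEN linear_cmul];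
      simp add: algebra_simps add_divide_distrib diff_divide_distrib)+

lemma linear_jump: "linear (\<lambda>c. jump z l (piola c))"
  by (intro linearI;
      simp only: jump_piola linear_traces[THEN linear_add] linear_traces[THEN linear_cmul];
      simp add: algebra_simps)

lemma T_tensor_eq: "T_tensor z j k = piola (T_coeffs j k)"
  by (simp add: T_tensor_def T_hat_eq piola_def)

lemma J_tensor_eq: "J_tensor z j = piola (J_coeffs j)"
  by (simp add: J_tensor_def J_hat_eq piola_def)

text \<open>The factor \<open>e\<^sub>j\<^sup>2 / det B\<close> arises since \<open>t\<^sub>j\<^sub>+\<^sub>1 \<bullet> n\<^sub>j = - det B / (e\<^sub>j e\<^sub>j\<^sub>+\<^sub>1)\<close>. It is the inverse
of the factor by which the transformation scales normal-normal traces on \<open>E\<^sub>j\<close>.\<close>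

lemma N_tilde_eq:
  "N_tilde z j k = piola (((edge_len z j)\<^sup>2 / det B) *\<^sub>R N_tilde_coeffs j k)"
proof
  fix x
  let ?w = "(if k = 0 then eta_hat j (inv F x) + eta_hat (j + 1) (inv F x)
             else eta_hat (j + 1) (inv F x) - eta_hat j (inv F x))"
  let ?t = "tangent ref_vertex (j + 1)"
  have "tangent z (j + 1) \<bullet> normal z j
      = 1 / edge_len z (j + 1) * (det B / edge_len z j) * (?t \<bullet> normal ref_vertex j)"
    unfolding tangent_eq inner_commute[of _ "normal z j"] inner_scaleR_right
      inner_matrix_transpose[of _ B] transpose_B_normal
    by (simp add: inner_commute)
  moreover have "?t \<bullet> normal ref_vertex j = - 1"
    by (cases j rule: exhaust_four)
       (simp_all add: tangent_ref normal_ref inner_vec_def sum_2 cyclic_five)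
  ultimately have c: "\<bar>tangent z (j + 1) \<bullet> normal z j\<bar>\<^sup>2
      = (det B)\<^sup>2 / ((edge_len z (j + 1))\<^sup>2 * (edge_len z j)\<^sup>2)"
    by (simp add: power_mult_distrib power_divide)
  have "outer (tangent z (j + 1)) (tangent z (j + 1))
      = (1 / (edge_len z (j + 1))\<^sup>2) *\<^sub>R outer (B *v ?t) (B *v ?t)"
    by (simp add: tangent_eq outer_def vec_eq_iff power2_eq_square)
  then have "N_tilde z j k x = ((edge_len z j)\<^sup>2 / (det B)\<^sup>2 * ?w) *\<^sub>R (B ** outer ?t ?t ** transpose B)"
    using edge_len_pos[of "j + 1"] by (simp add: N_tilde_def c[unfolded power2_abs] eta_def outer_matrix_vector)
  moreover have "piola (((edge_len z j)\<^sup>2 / det B) *\<^sub>R N_tilde_coeffs j k) x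
      = ((edge_len z j)\<^sup>2 / det B) *\<^sub>R (1 / det B) *\<^sub>R ?w *\<^sub>R (B ** outer ?t ?t ** transpose B)"
  proof -
    interpret congr: bounded_linear "\<lambda>X. (1 / det B) *\<^sub>R (B ** X ** transpose B)"
      by (rule bounded_linear_congruence)
    have "piola (((edge_len z j)\<^sup>2 / det B) *\<^sub>R N_tilde_coeffs j k) x
      = ((edge_len z j)\<^sup>2 / det B) *\<^sub>R PK z (hat_field (N_tilde_coeffs j k)) x"
      unfolding linear_cmul[OF linear_piola] by (simp add: piola_def scaleR_fun_def)
    also have "PK z (hat_field (N_tilde_coeffs j k)) x
        = ?w *\<^sub>R ((1 / det B) *\<^sub>R (B ** outer ?t ?t ** transpose B))"
      unfolding PK_def N_tilde_coeffs_eq by (rule congr.scaleR)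
    finally show ?thesis
      by (simp only: scaleR_left_commute)
  qed
  ultimately show "N_tilde z j k x = piola (((edge_len z j)\<^sup>2 / det B) *\<^sub>R N_tilde_coeffs j k) x"
    by (simp add: power2_eq_square)
qed

definition N_coeffs :: "4 \<Rightarrow> nat \<Rightarrow> coeffs" where
  "N_coeffs j k = ((edge_len z j)\<^sup>2 / det B) *\<^sub>R N_tilde_coeffs j k
     - (\<Sum>l\<in>UNIV. \<Sum>m\<in>{0, 1}. dof_t z l m (N_tilde z j k) *\<^sub>R T_coeffs l m)
     - (\<Sum>l\<in>UNIV. jump z l (N_tilde z j k) *\<^sub>R J_coeffs l)"

lemma N_tensor_eq: "N_tensor z j k = piola (N_coeffs j k)"
  by (simp only: N_tensor_def N_coeffs_def linear_diff[OF linear_piola] linear_sum[OF linear_piola]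
      linear_cmul[OF linear_piola] T_tensor_eq J_tensor_eq N_tilde_eq dof_t_def)

lemma T_dofs:
  assumes "m \<in> {0, 1}" "k \<in> {0, 1}"
  shows "dof_n z l m (T_tensor z j k) = 0"
    and "dof_t z l m (T_tensor z j k) = (if (l, m) = (j, k) then 1 else 0)"
    and "jump z l (T_tensor z j k) = 0"
  using assms T_coeffs_traces(2)[of "l - 1" j k]
  by (auto simp: T_tensor_eq dof_n_piola[unfolded One_nat_def] dof_t_piola[unfolded One_nat_def]
       jump_piola T_coeffs_traces)

lemma J_dofs:
  assumes "m \<in> {0, 1}"
  shows "dof_n z l m (J_tensor z j) = 0"
    and "dof_t z l m (J_tensor z j) = 0"
    and "jump z l (J_tensor z j) = (if l = j then 1 else 0)"
  using assms J_coeffs_traces(2)[of "l - 1" j]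
  by (auto simp: J_tensor_eq dof_n_piola[unfolded One_nat_def] dof_t_piola[unfolded One_nat_def]
       jump_piola J_coeffs_traces)

text \<open>The definition of \<open>N_tensor\<close>, seen through a linear functional: every degree of freedom can now
be evaluated from the duality of \<open>T\<close> and \<open>J\<close>.\<close>

lemma N_functional:
  assumes "linear (\<lambda>c. f (piola c))"
  shows "f (N_tensor z j k) = f (N_tilde z j k)
     - (\<Sum>l\<in>UNIV. \<Sum>m\<in>{0, 1}. dof_t z l m (N_tilde z j k) * f (T_tensor z l m))
     - (\<Sum>l\<in>UNIV. jump z l (N_tilde z j k) * f (J_tensor z l))"
  unfolding N_tensor_eq N_coeffs_def linear_diff[OF assms] linear_sum[OF assms]
      linear_cmul[OF assms] T_tensor_eq[symmetric] J_tensor_eq[symmetric]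
  by (simp add: N_tilde_eq linear_cmul[OF assms])

lemma N_dofs:
  assumes m: "m \<in> {0, 1 :: nat}" and k: "k \<in> {0, 1}"
  shows "dof_n z l m (N_tensor z j k) = (if (l, m) = (j, k) then 1 else 0)"
    and "dof_t z l m (N_tensor z j k) = 0"
    and "jump z l (N_tensor z j k) = 0"
proof -
  have "dof_n z l m (N_tensor z j k) = dof_n z l m (N_tilde z j k)"
    by (simp add: N_functional[OF linear_dof(1)[OF m]] T_dofs(1)[OF m] J_dofs(1)[OF m])
  also have "\<dots> = (edge_len z j)\<^sup>2 / det B * dof_n z l m (piola (N_tilde_coeffs j k))"
    unfolding N_tilde_eq linear_cmul[OF linear_dof(1)[OF m]] by simp
  also have "\<dots> = (if (l, m) = (j, k) then 1 else 0)"
    using m k edge_len_pos[of j] det_pos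
    by (auto simp: dof_n_piola[unfolded One_nat_def] N_tilde_coeffs_traces)
  finally show "dof_n z l m (N_tensor z j k) = (if (l, m) = (j, k) then 1 else 0)" .
  have "(\<Sum>i\<in>UNIV. \<Sum>m'\<in>{0, 1}. a i m' * (if (l, m) = (i, m') then 1 else 0)) = a l m"
    for a :: "4 \<Rightarrow> nat \<Rightarrow> real"
  proof -
    have "(\<Sum>m'\<in>{0, 1}. a i m' * (if (l, m) = (i, m') then 1 else 0))
        = (if l = i then a i m else 0)" for i
      using m by auto
    then show ?thesis
      by simp
  qed
  then show "dof_t z l m (N_tensor z j k) = 0"
    by (simp only: N_functional[OF linear_dof(2)[OF m]] T_dofs(2)[OF m] J_dofs(2)[OF m] cong: sum.cong) simp
  have "(\<Sum>i\<in>UNIV. a i * (if l = i then 1 else 0)) = a l" for a :: "4 \<Rightarrow> real"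
    by (simp add: if_distrib cong: if_cong)
  then show "jump z l (N_tensor z j k) = 0"
    by (simp add: N_functional[OF linear_jump] T_dofs(3) J_dofs(3)[OF m])
qed

end

section \<open>The space as an image of the reference space\<close>

lemma Pol_1: "f \<in> Pol 1 \<longleftrightarrow> (\<exists>a b c. f = (\<lambda>x. a + b * x $ 1 + c * x $ 2))"
proof
  assume "f \<in> Pol 1"
  then have "f \<in> span {\<lambda>x. (x $ 1) ^ i * (x $ 2) ^ j | i j. i + j \<le> 1}"
    by (simp add: Pol_def)
  then show "\<exists>a b c. f = (\<lambda>x. a + b * x $ 1 + c * x $ 2)"
  proof (induction rule: span_induct)
    case (step g)
    then obtain i j :: nat where g: "g = (\<lambda>x. (x $ 1) ^ i * (x $ 2) ^ j)" and "i + j \<le> 1"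
      by blast
    then consider "i = 0" "j = 0" | "i = 1" "j = 0" | "i = 0" "j = 1"
      by linarith
    then show ?case
    proof cases
      case 1
      show ?thesis
        by (rule exI[of _ 1], rule exI[of _ 0], rule exI[of _ 0]) (simp add: g 1)
    next
      case 2
      show ?thesis
        by (rule exI[of _ 0], rule exI[of _ 1], rule exI[of _ 0]) (simp add: g 2)
    next
      case 3
      show ?thesis
        by (rule exI[of _ 0], rule exI[of _ 0], rule exI[of _ 1]) (simp add: g 3)
    qed
  next
    case base
    show ?case
      unfolding subspace_def
    proof (safe, goal_cases)
      case 1
      show ?case
        by (rule exI[of _ 0], rule exI[of _ 0], rule exI[of _ 0]) (simp add: zero_fun_def)
    next
      case (2 f g a a' b b' c c')
      show ?case
        by (rule exI[of _ "a + a'"], rule exI[of _ "b + b'"], rule exI[of _ "c + c'"])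
           (simp add: fun_eq_iff algebra_simps)
    next
      case (3 r f a b c)
      show ?case
        by (rule exI[of _ "r * a"], rule exI[of _ "r * b"], rule exI[of _ "r * c"])
           (simp add: fun_eq_iff scaleR_fun_def algebra_simps)
    qed
  qed
next
  assume "\<exists>a b c. f = (\<lambda>x. a + b * x $ 1 + c * x $ 2)"
  then obtain a b c where f: "f = (\<lambda>x. a + b * x $ 1 + c * x $ 2)"
    by blast
  let ?S = "{\<lambda>x :: point. (x $ 1) ^ i * (x $ 2) ^ j | i j. i + j \<le> (1 :: nat)}"
  have "(\<lambda>x. (x $ 1) ^ i * (x $ 2) ^ j) \<in> span ?S" if "i + j \<le> 1" for i j
    using that by (intro span_base) blast
  from this[of 0 0] this[of 1 0] this[of 0 1]
  have "a *\<^sub>R (\<lambda>x. 1) + b *\<^sub>R (\<lambda>x. x $ 1) + c *\<^sub>R (\<lambda>x. x $ 2) \<in> span ?S"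
    by (intro span_add span_scale) simp_all
  moreover have "a *\<^sub>R (\<lambda>x. 1) + b *\<^sub>R (\<lambda>x. x $ 1) + c *\<^sub>R (\<lambda>x. x $ 2) = f"
    by (simp add: f fun_eq_iff scaleR_fun_def)
  ultimately show "f \<in> Pol 1"
    by (simp add: Pol_def)
qed

lemma Pol_hom_1: "q \<in> Pol_hom 1 \<longleftrightarrow> (\<exists>w. q = (\<lambda>x. w \<bullet> x))"
proof
  assume "q \<in> Pol_hom 1"
  then have "q \<in> span {\<lambda>x. (x $ 1) ^ i * (x $ 2) ^ j | i j. i + j = 1}"
    by (simp add: Pol_hom_def)
  then show "\<exists>w. q = (\<lambda>x. w \<bullet> x)"
  proof (induction rule: span_induct)
    case (step g)
    then obtain i j :: nat where g: "g = (\<lambda>x. (x $ 1) ^ i * (x $ 2) ^ j)" and "i + j = 1"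
      by blast
    then consider "i = 1" "j = 0" | "i = 0" "j = 1"
      by linarith
    then show ?case
    proof cases
      case 1
      show ?thesis
        by (rule exI[of _ "vector [1, 0]"]) (simp add: g 1 inner_vec_def sum_2)
    next
      case 2
      show ?thesis
        by (rule exI[of _ "vector [0, 1]"]) (simp add: g 2 inner_vec_def sum_2)
    qed
  next
    case base
    show ?case
      unfolding subspace_def
    proof (safe, goal_cases)
      case 1
      show ?case
        by (rule exI[of _ 0]) (simp add: zero_fun_def fun_eq_iff)
    next
      case (2 f g w w')
      show ?case
        by (rule exI[of _ "w + w'"]) (simp add: fun_eq_iff inner_add_left)
    next
      case (3 r f w)
      show ?case
        by (rule exI[of _ "r *\<^sub>R w"]) (simp add: fun_eq_iff scaleR_fun_def)
    qed
  qed
next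
  assume "\<exists>w. q = (\<lambda>x. w \<bullet> x)"
  then obtain w where q: "q = (\<lambda>x. w \<bullet> x)"
    by blast
  let ?S = "{\<lambda>x :: point. (x $ 1) ^ i * (x $ 2) ^ j | i j. i + j = (1 :: nat)}"
  have "(\<lambda>x. (x $ 1) ^ i * (x $ 2) ^ j) \<in> span ?S" if "i + j = 1" for i j
    using that by (intro span_base) blast
  from this[of 1 0] this[of 0 1]
  have "w $ 1 *\<^sub>R (\<lambda>x. x $ 1) + w $ 2 *\<^sub>R (\<lambda>x. x $ 2) \<in> span ?S"
    by (intro span_add span_scale) simp_all
  moreover have "w $ 1 *\<^sub>R (\<lambda>x. x $ 1) + w $ 2 *\<^sub>R (\<lambda>x. x $ 2) = q"
    by (simp add: q fun_eq_iff scaleR_fun_def inner_vec_def sum_2)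
  ultimately show "q \<in> Pol_hom 1"
    by (simp add: Pol_hom_def)
qed

text \<open>The form used for all affine changes of variables below.\<close>

lemma RT_1: "\<psi> \<in> RT 1 \<longleftrightarrow> (\<exists>u A w. \<psi> = (\<lambda>x. u + A *v x + (w \<bullet> x) *\<^sub>R x))"
proof
  assume "\<psi> \<in> RT 1"
  then obtain v q where \<psi>: "\<psi> = (\<lambda>x. v x + q x *\<^sub>R x)" and v: "\<And>i. (\<lambda>x. v x $ i) \<in> Pol 1"
    and q: "q \<in> Pol_hom 1"
    by (auto simp: RT_def)
  obtain w where w: "q = (\<lambda>x. w \<bullet> x)"
    using q Pol_hom_1 by blast
  obtain a b c where "(\<lambda>x. v x $ i) = (\<lambda>x. a i + b i * x $ 1 + c i * x $ 2)" for i
    using v unfolding Pol_1 by metis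
  then have "v x $ i = a i + b i * x $ 1 + c i * x $ 2" for x i
    by (rule fun_cong)
  then have "\<psi> = (\<lambda>x. (\<chi> i. a i) + (\<chi> i j. if j = 1 then b i else c i) *v x + (w \<bullet> x) *\<^sub>R x)"
    by (simp add: \<psi> w fun_eq_iff vec_eq_iff matrix_vector_mult_def sum_2)
  then show "\<exists>u A w. \<psi> = (\<lambda>x. u + A *v x + (w \<bullet> x) *\<^sub>R x)"
    by blast
next
  assume "\<exists>u A w. \<psi> = (\<lambda>x. u + A *v x + (w \<bullet> x) *\<^sub>R x)"
  then obtain u A w where \<psi>: "\<psi> = (\<lambda>x. u + A *v x + (w \<bullet> x) *\<^sub>R x)"
    by blast
  have "(\<lambda>x. (u + A *v x) $ i) \<in> Pol 1" for i
    unfolding Pol_1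
    by (rule exI[of _ "u $ i"], rule exI[of _ "A $ i $ 1"], rule exI[of _ "A $ i $ 2"])
       (simp add: matrix_vector_mult_def sum_2 algebra_simps)
  moreover have "(\<lambda>x. w \<bullet> x) \<in> Pol_hom 1"
    unfolding Pol_hom_1 by blast
  ultimately show "\<psi> \<in> RT 1"
    unfolding RT_def \<psi>
mem_Collect_eq
    by (auto intro!: exI[of _ "\<lambda>x. u + A *v x"] exI[of _ "\<lambda>x. w \<bullet> x"])
qed

lemma outer_mult_vector: "outer v w *v x = (w \<bullet> x) *\<^sub>R v"
  by (simp add: outer_def vec_eq_iff matrix_vector_mult_def inner_vec_def sum_2 algebra_simps)

text \<open>Raviart--Thomas spaces are invariant under Piola transformations. A translation by \<open>b\<close> turns
\<open>(w \<bullet> x) x\<close> into itself plus an affine field.\<close>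

lemma RT_1_affine:
  assumes "\<psi> \<in> RT 1" "P ** Q = mat 1"
  shows "(\<lambda>x. P *v \<psi> (Q *v x + b)) \<in> RT 1"
proof -
  obtain u A w where \<psi>: "\<psi> = (\<lambda>x. u + A *v x + (w \<bullet> x) *\<^sub>R x)"
    using assms(1) RT_1 by blast
  let ?u = "P *v (u + A *v b + (w \<bullet> b) *\<^sub>R b)"
  let ?A = "P ** A ** Q + (w \<bullet> b) *\<^sub>R mat 1 + outer (P *v b) (transpose Q *v w)"
  have PQ: "P *v (Q *v x) = x" for x
    by (simp add: matrix_vector_mul_assoc assms(2))
  have "(\<lambda>x. P *v \<psi> (Q *v x + b)) = (\<lambda>x. ?u + ?A *v x + ((transpose Q *v w) \<bullet> x) *\<^sub>R x)"
  proof
    fix x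
    have w: "(transpose Q *v w) \<bullet> x = w \<bullet> (Q *v x)"
      by (simp add: dot_lmul_matrix)
    show "P *v \<psi> (Q *v x + b) = ?u + ?A *v x + ((transpose Q *v w) \<bullet> x) *\<^sub>R x"
      unfolding \<psi> matrix_vector_mult_add_rdistrib outer_mult_vector w
      by (simp add: matrix_vector_right_distrib matrix_vector_mult_scaleR PQ inner_add_right
          scaleR_add_left scaleR_add_right matrix_vector_mul_assoc[symmetric]
          scaleR_matrix_vector_assoc[symmetric] del: transpose_matrix_vector)
  qed
  then show ?thesis
    using RT_1 by blast
qed

text \<open>The cubic terms of the product are \<open>x q\<close> and \<open>y q\<close> times \<open>(x, y)\<close> with the linear form \<open>q = w \<bullet> p\<close>,
which is why the four coefficients \<open>d\<close> describe them.\<close>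

lemma sym_part_outer_eq_hat_field:
  "sym_part (outer (vector [\<alpha>0 + \<alpha>1 * p $ 1, \<beta>0 + \<beta>1 * p $ 2]) (u + A *v p + (w \<bullet> p) *\<^sub>R p))
   = hat_field
      ((\<alpha>0 * u $ 1, \<alpha>0 * A $ 1 $ 1 + \<alpha>1 * u $ 1, \<alpha>0 * A $ 1 $ 2, \<alpha>0 * w $ 1 + \<alpha>1 * A $ 1 $ 1,
        \<alpha>0 * w $ 2 + \<alpha>1 * A $ 1 $ 2),
       ((\<alpha>0 * u $ 2 + \<beta>0 * u $ 1) / 2, (\<alpha>0 * A $ 2 $ 1 + \<alpha>1 * u $ 2 + \<beta>0 * A $ 1 $ 1) / 2,
        (\<alpha>0 * A $ 2 $ 2 + \<beta>0 * A $ 1 $ 2 + \<beta>1 * u $ 1) / 2, (\<alpha>1 * A $ 2 $ 1 + \<beta>0 * w $ 1) / 2,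
        (\<alpha>0 * w $ 1 + \<alpha>1 * A $ 2 $ 2 + \<beta>0 * w $ 2 + \<beta>1 * A $ 1 $ 1) / 2,
        (\<alpha>0 * w $ 2 + \<beta>1 * A $ 1 $ 2) / 2),
       (\<beta>0 * u $ 2, \<beta>0 * A $ 2 $ 1, \<beta>0 * A $ 2 $ 2 + \<beta>1 * u $ 2, \<beta>0 * w $ 1 + \<beta>1 * A $ 2 $ 1,
        \<beta>0 * w $ 2 + \<beta>1 * A $ 2 $ 2),
       (\<alpha>1 * w $ 1, \<alpha>1 * w $ 2, \<beta>1 * w $ 1, \<beta>1 * w $ 2)) p"
  by (simp add: sym_part_def outer_def sym_mat_def vec_eq_iff forall_2 transpose_def Let_def
      matrix_vector_mult_def inner_vec_def sum_2 field_simps power2_eq_square power3_eq_cube)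

lemma linear_sym_part: "linear (\<lambda>(M :: tensor_field) x. sym_part (M x))"
  by (rule linearI)
     (simp_all add: sym_part_def fun_eq_iff vec_eq_iff transpose_def scaleR_fun_def algebra_simps)

lemma sym_part_congruence: "sym_part (A ** X ** transpose A) = A ** sym_part X ** transpose A"
  by (simp add: sym_part_def vec_eq_iff forall_2 transpose_def matrix_matrix_mult_def sum_2 algebra_simps)

context parallelogram_element
begin

lemma RT_1_pullback:
  "\<psi> \<in> RT 1 \<longleftrightarrow> (\<exists>u A w. \<psi> = (\<lambda>x. B *v (u + A *v inv F x + (w \<bullet> inv F x) *\<^sub>R inv F x)))"
proof -
  have "invertible B"
    using det_pos by (simp add: invertible_det_nz)
  then obtain C where C: "C ** B = mat 1" "B ** C = mat 1"
    by (auto simp: invertible_def)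
  have inv: "inv F x = C *v x + - (C *v z 1)" for x
  proof -
    have "C *v (F (inv F x) - z 1) = inv F x"
      by (simp add: F_map_def matrix_vector_mul_assoc C)
    then show ?thesis
      by (simp add: matrix_vector_mult_diff_distrib)
  qed
  show ?thesis
  proof
    assume "\<psi> \<in> RT 1"
    then have "(\<lambda>p. C *v \<psi> (F p)) \<in> RT 1"
      unfolding F_map_def by (rule RT_1_affine) (rule C)
    then obtain u A w where "(\<lambda>p. C *v \<psi> (F p)) = (\<lambda>x. u + A *v x + (w \<bullet> x) *\<^sub>R x)"
      using RT_1 by blast
    then have "C *v \<psi> (F p) = u + A *v p + (w \<bullet> p) *\<^sub>R p" for p
      by (rule fun_cong)
    from this[of "inv F x" for x]
    have "B *v (C *v \<psi> x) = B *v (u + A *v inv F x + (w \<bullet> inv F x) *\<^sub>R inv F x)" for x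
      by simp
    then have "\<psi> = (\<lambda>x. B *v (u + A *v inv F x + (w \<bullet> inv F x) *\<^sub>R inv F x))"
      by (simp add: matrix_vector_mul_assoc C fun_eq_iff)
    then show "\<exists>u A w. \<psi> = (\<lambda>x. B *v (u + A *v inv F x + (w \<bullet> inv F x) *\<^sub>R inv F x))"
      by blast
  next
    assume "\<exists>u A w. \<psi> = (\<lambda>x. B *v (u + A *v inv F x + (w \<bullet> inv F x) *\<^sub>R inv F x))"
    then obtain u A w
      where \<psi>: "\<psi> = (\<lambda>x. B *v (u + A *v inv F x + (w \<bullet> inv F x) *\<^sub>R inv F x))"
      by blast
    have "(\<lambda>x. u + A *v x + (w \<bullet> x) *\<^sub>R x) \<in> RT 1"
      using RT_1 by blast
    from RT_1_affine[OF this C(2)] show "\<psi> \<in> RT 1"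
      unfolding \<psi> inv .
  qed
qed

lemma Q0_pullback:
  "\<phi> \<in> Q0 z \<longleftrightarrow> (\<exists>\<alpha>0 \<alpha>1 \<beta>0 \<beta>1. \<phi> = (\<lambda>x. (1 / det B) *\<^sub>R
     (B *v vector [\<alpha>0 + \<alpha>1 * inv F x $ 1, \<beta>0 + \<beta>1 * inv F x $ 2])))"
proof -
  let ?S = "{\<lambda>x :: point. vector [1, 0] :: real ^ 2, \<lambda>x. vector [0, 1],
      \<lambda>x. vector [x $ 1, 0], \<lambda>x. vector [0, x $ 2]}"
  let ?f = "\<lambda>\<alpha>0 \<alpha>1 \<beta>0 \<beta>1 (x :: point). vector [\<alpha>0 + \<alpha>1 * x $ 1, \<beta>0 + \<beta>1 * x $ 2] :: real ^ 2"
  have f: "?f \<alpha>0 \<alpha>1 \<beta>0 \<beta>1 = \<alpha>0 *\<^sub>R (\<lambda>x. vector [1, 0]) + \<beta>0 *\<^sub>R (\<lambda>x. vector [0, 1])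
      + \<alpha>1 *\<^sub>R (\<lambda>x. vector [x $ 1, 0]) + \<beta>1 *\<^sub>R (\<lambda>x. vector [0, x $ 2])" for \<alpha>0 \<alpha>1 \<beta>0 \<beta>1
    by (simp add: fun_eq_iff scaleR_fun_def vec_eq_iff forall_2)
  have span: "g \<in> span ?S \<longleftrightarrow> (\<exists>\<alpha>0 \<alpha>1 \<beta>0 \<beta>1. g = ?f \<alpha>0 \<alpha>1 \<beta>0 \<beta>1)" for g
  proof
    assume "g \<in> span ?S"
    then obtain \<alpha>0 \<beta>0 \<alpha>1 \<beta>1 where
      "g - \<alpha>0 *\<^sub>R (\<lambda>x. vector [1, 0]) - \<beta>0 *\<^sub>R (\<lambda>x. vector [0, 1])
      - \<alpha>1 *\<^sub>R (\<lambda>x. vector [x $ 1, 0]) - \<beta>1 *\<^sub>R (\<lambda>x. vector [0, x $ 2]) = 0"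
      unfolding span_breakdown_eq by auto
    then have "g = ?f \<alpha>0 \<alpha>1 \<beta>0 \<beta>1"
      unfolding f by (simp add: algebra_simps)
    then show "\<exists>\<alpha>0 \<alpha>1 \<beta>0 \<beta>1. g = ?f \<alpha>0 \<alpha>1 \<beta>0 \<beta>1"
      by blast
  next
    assume "\<exists>\<alpha>0 \<alpha>1 \<beta>0 \<beta>1. g = ?f \<alpha>0 \<alpha>1 \<beta>0 \<beta>1"
    then obtain \<alpha>0 \<alpha>1 \<beta>0 \<beta>1 where g: "g = ?f \<alpha>0 \<alpha>1 \<beta>0 \<beta>1"
      by blast
    show "g \<in> span ?S"
      unfolding g f by (intro span_add span_scale span_base) simp_all
  qed
  have eq: "(\<forall>p. det B *\<^sub>R \<phi> (F p) = B *v g p) \<longleftrightarrow> \<phi> = (\<lambda>x. (1 / det B) *\<^sub>R (B *v g (inv F x)))" for g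
  proof
    assume *: "\<forall>p. det B *\<^sub>R \<phi> (F p) = B *v g p"
    have "\<phi> x = (1 / det B) *\<^sub>R (B *v g (inv F x))" for x
      using *[rule_format, of "inv F x", symmetric] det_pos by simp
    then show "\<phi> = (\<lambda>x. (1 / det B) *\<^sub>R (B *v g (inv F x)))"
      by blast
  qed (use det_pos in simp)
  have ex: "(\<exists>g. (\<exists>a b c d. g = f a b c d) \<and> P g) \<longleftrightarrow> (\<exists>a b c d. P (f a b c d))"
    for f :: "real \<Rightarrow> real \<Rightarrow> real \<Rightarrow> real \<Rightarrow> vector_field" and P
    by blast
  show ?thesis
    unfolding Q0_def mem_Collect_eq Bex_def span eq by (rule ex)
qed

lemma sym_part_outer_pushforward:
  "sym_part (outer ((1 / det B) *\<^sub>R (B *v v)) (B *v w))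
    = (1 / det B) *\<^sub>R (B ** sym_part (outer v w) ** transpose B)"
proof -
  have "outer ((1 / det B) *\<^sub>R (B *v v)) (B *v w) = (1 / det B) *\<^sub>R (B ** outer v w ** transpose B)"
    by (simp add: outer_def vec_eq_iff forall_2 matrix_vector_mult_def matrix_matrix_mult_def sum_2
      transpose_def algebra_simps add_divide_distrib)
  moreover have "sym_part (r *\<^sub>R X) = r *\<^sub>R sym_part X" for r X
    by (simp add: sym_part_def vec_eq_iff transpose_def algebra_simps)
  ultimately show ?thesis
    by (simp add: sym_part_congruence)
qed

text \<open>Both factors of the tensor product pull back to their reference counterparts. Conversely, four
products suffice to produce every coordinate vector.\<close>

lemma X_space_eq: "X_space z = range piola"
proof
  have sub: "subspace (range piola)"
    by (rule linear_subspace_image[OF linear_piola subspace_UNIV])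
  let ?S = "{\<lambda>x. outer (\<phi> x) (\<psi> x) |\<phi> \<psi>. \<phi> \<in> Q0 z \<and> \<psi> \<in> RT 1}"
  show "X_space z \<subseteq> range piola"
  proof
    fix N assume "N \<in> X_space z"
    then obtain M where M: "M \<in> span ?S" "N = (\<lambda>x. sym_part (M x))"
      by (auto simp: X_space_def tensor_space_def)
    from M(1) have "(\<lambda>x. sym_part (M x)) \<in> range piola"
    proof (induction rule: span_induct)
      case (step M)
      then obtain \<phi> \<psi> where M: "M = (\<lambda>x. outer (\<phi> x) (\<psi> x))" "\<phi> \<in> Q0 z" "\<psi> \<in> RT 1"
        by blast
      obtain \<alpha>0 \<alpha>1 \<beta>0 \<beta>1 where \<phi>: "\<phi> = (\<lambda>x. (1 / det B) *\<^sub>R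
          (B *v vector [\<alpha>0 + \<alpha>1 * inv F x $ 1, \<beta>0 + \<beta>1 * inv F x $ 2]))"
        using M(2) Q0_pullback by blast
      obtain u A w where \<psi>: "\<psi> = (\<lambda>x. B *v (u + A *v inv F x + (w \<bullet> inv F x) *\<^sub>R inv F x))"
        using M(3) RT_1_pullback by blast
      show ?case
        unfolding M(1) \<phi> \<psi> sym_part_outer_pushforward sym_part_outer_eq_hat_field piola_def
          PK_def[abs_def] by (rule range_eqI, rule refl)
    next
      case base
      show ?case
        using linear_subspace_linear_preimage[OF linear_sym_part sub] .
    qed
    then show "N \<in> range piola"
      using M(2) by simp
  qed
  have subX: "subspace (X_space z)"
    unfolding X_space_def tensor_space_def by (rule linear_subspace_image[OF linear_sym_part subspace_span])
  have X: "PK z (\<lambda>p. sym_part (outer (vector [\<alpha>0 + \<alpha>1 * p $ 1, \<beta>0 + \<beta>1 * p $ 2])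
      (u + A *v p + (w \<bullet> p) *\<^sub>R p))) \<in> X_space z" for \<alpha>0 \<alpha>1 \<beta>0 \<beta>1 u A w
  proof -
    let ?\<phi> = "\<lambda>x. (1 / det B) *\<^sub>R (B *v vector [\<alpha>0 + \<alpha>1 * inv F x $ 1, \<beta>0 + \<beta>1 * inv F x $ 2])"
    let ?\<psi> = "\<lambda>x. B *v (u + A *v inv F x + (w \<bullet> inv F x) *\<^sub>R inv F x)"
    have outer: "(\<lambda>x. outer (\<phi> x) (\<psi> x)) \<in> span ?S" if "\<phi> \<in> Q0 z" "\<psi> \<in> RT 1" for \<phi> \<psi>
      using that by (intro span_base) blast
    have "?\<phi> \<in> Q0 z" "?\<psi> \<in> RT 1"
      using Q0_pullback RT_1_pullback by blast+
    then have "(\<lambda>x. outer (?\<phi> x) (?\<psi> x)) \<in> span ?S"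
      by (rule outer)
    then have "(\<lambda>x. sym_part (outer (?\<phi> x) (?\<psi> x))) \<in> X_space z"
      unfolding X_space_def tensor_space_def
      by (rule image_eqI[rotated]) (rule refl)
    then show ?thesis
      unfolding sym_part_outer_pushforward PK_def[abs_def] .
  qed
  show "range piola \<subseteq> X_space z"
  proof safe
    fix c :: coeffs
    obtain a0 a1 a2 a3 a4 b0 b1 b2 b3 b4 b5 c0 c1 c2 c3 c4 d1 d2 d3 d4 where c:
      "c = ((a0, a1, a2, a3, a4), (b0, b1, b2, b3, b4, b5), (c0, c1, c2, c3, c4), (d1, d2, d3, d4))"
      by (rule coeffs_cases)
    let ?X = "\<lambda>\<alpha>0 \<alpha>1 \<beta>0 \<beta>1 u A w (p :: point). sym_part (outer
      (vector [\<alpha>0 + \<alpha>1 * p $ 1, \<beta>0 + \<beta>1 * p $ 2]) (u + A *v p + (w \<bullet> p) *\<^sub>R p))"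
    \<comment> \<open>The four products belong to the fields \<open>(1, 0)\<close>, \<open>(x, 0)\<close>, \<open>(0, 1)\<close>, \<open>(0, y)\<close> that span the
reference \<open>Q\<^sup>0\<close>. Entry 12 of the symmetric part carries the factor 1/2.\<close>
    have "hat_field c =
        ?X 1 0 0 0 (vector [a0, 2 * b0]) (vector [vector [a1, a2], vector [2 * b1, 2 * b2]]) 0
      + ?X 0 1 0 0 0 (vector [vector [a3, a4], vector [2 * b3, 2 * b4]]) (vector [d1, d2])
      + ?X 0 0 1 0 (vector [0, c0]) (vector [vector [0, 0], vector [c1, c2]]) 0
      + ?X 0 0 0 1 0 (vector [vector [0, 2 * b5], vector [c3, c4]]) (vector [d3, d4])"
      unfolding fun_eq_iff plus_fun_apply sym_part_outer_eq_hat_field c hat_field.simps Let_def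
      by (simp add: sym_mat_def vec_eq_iff forall_2 algebra_simps add_divide_distrib)
    then show "piola c \<in> X_space z"
      unfolding piola_def by (simp only: linear_add[OF linear_PK] subspace_add[OF subX] X)
  qed
qed

end

section \<open>Dual families and bases\<close>

text \<open>A family with dual functionals is independent, because the functional dual to a member vanishes
on the span of the others. As many independent vectors as the dimension of the domain span the
range of a linear map. The functionals need to be linear only along \<open>\<Phi>\<close>: traces and integrals are
not linear on arbitrary, possibly irregular, fields.\<close>

lemma dual_families:
  fixes \<Phi> :: "'e::euclidean_space \<Rightarrow> 'v::real_vector" and f :: "'i \<Rightarrow> 'v \<Rightarrow> real"
  assumes lin: "linear \<Phi>"
    and I: "finite I" "card I = DIM('e)"
    and b: "\<And>i. i \<in> I \<Longrightarrow> b i \<in> range \<Phi>"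
    and f: "\<And>i. i \<in> I \<Longrightarrow> linear (\<lambda>c. f i (\<Phi> c))"
    and dual: "\<And>i j. i \<in> I \<Longrightarrow> j \<in> I \<Longrightarrow> f i (b j) = (if i = j then 1 else 0)"
  shows "independent (b ` I)" "span (b ` I) = range \<Phi>"
proof -
  define c where "c i = (SOME x. b i = \<Phi> x)" for i
  have c: "b i = \<Phi> (c i)" if "i \<in> I" for i
    unfolding c_def by (rule someI_ex) (use b[OF that] in blast)
  \<comment> \<open>The functionals are linear only along \<open>\<Phi>\<close>, so that the span is first lifted to the domain.\<close>
  have kernel: "f i v = 0" if v: "v \<in> span (b ` (I - {i}))" and i: "i \<in> I" for i v
  proof -
    have "b ` (I - {i}) = \<Phi> ` (c ` (I - {i}))"
      using c by (auto simp: image_image)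
    then have "span (b ` (I - {i})) = \<Phi> ` span (c ` (I - {i}))"
      by (simp add: linear_span_image[OF lin])
    then obtain w where w: "w \<in> span (c ` (I - {i}))" "v = \<Phi> w"
      using v by blast
    from w(1) have "f i (\<Phi> w) = 0"
    proof (induction rule: span_induct)
      case (step w)
      then obtain j where "j \<in> I" "j \<noteq> i" "w = c j"
        by blast
      then show ?case
        using dual[OF i, of j] c[of j] by simp
    next
      case base
      show ?case
        using linear_0[OF f[OF i]] linear_add[OF f[OF i]] linear_cmul[OF f[OF i]]
        by (simp add: subspace_def)
    qed
    then show ?thesis
      by (simp add: w(2))
  qed
  have inj: "inj_on b I"
  proof (rule inj_onI)
    fix i j
    assume "i \<in> I" "j \<in> I" "b i = b j"
    then show "i = j"
      using dual[of i i] dual[of i j] by (simp split: if_splits)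
  qed
  show indep: "independent (b ` I)"
  proof
    assume "dependent (b ` I)"
    then obtain i where i: "i \<in> I" "b i \<in> span (b ` I - {b i})"
      by (auto simp: dependent_def)
    moreover have "b ` I - {b i} = b ` (I - {i})"
      using inj i(1) by (auto simp: inj_on_def)
    ultimately have "f i (b i) = 0"
      by (intro kernel) simp_all
    then show False
      using dual[OF i(1) i(1)] by simp
  qed
  \<comment> \<open>One more independent vector in the range would exceed the number of generators \<open>\<Phi> ` Basis\<close>.\<close>
  have range: "range \<Phi> = span (\<Phi> ` Basis)"
    by (simp add: linear_span_image[OF lin])
  have "v \<in> span (b ` I)" if v: "v \<in> range \<Phi>" for v
  proof (rule ccontr)
    assume nv: "v \<notin> span (b ` I)"
    then have "independent (insert v (b ` I))"
      using indep by (simp add: independent_insert span_base)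
    moreover have "insert v (b ` I) \<subseteq> span (\<Phi> ` Basis)"
      using v b range by auto
    ultimately have "card (insert v (b ` I)) \<le> card (\<Phi> ` Basis)"
      using independent_span_bound[of "\<Phi> ` Basis"] by simp
    also have "\<dots> \<le> DIM('e)"
      by (simp add: card_image_le)
    finally have "card (insert v (b ` I)) \<le> DIM('e)" .
    moreover have "v \<notin> b ` I"
      using nv by (rule contrapos_nn) (rule span_base)
    then have "card (insert v (b ` I)) = Suc DIM('e)"
      using I inj by (simp add: card_image)
    ultimately show False
      by simp
  qed
  moreover have "span (b ` I) \<subseteq> range \<Phi>"
    using b by (intro span_minimal linear_subspace_image[OF lin] subspace_UNIV) auto
  ultimately show "span (b ` I) = range \<Phi>"
    by blast
qed

text \<open>An index for the 20 functionals and, at the same time, for the 20 tensors dual to them.\<close>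

datatype dof = Normal 4 nat | Tangential 4 nat | Corner 4

definition dofs :: "dof set" where
  "dofs = case_prod Normal ` (UNIV \<times> {0, 1}) \<union> case_prod Tangential ` (UNIV \<times> {0, 1}) \<union> range Corner"

fun dof_functional :: "vertices \<Rightarrow> dof \<Rightarrow> tensor_field \<Rightarrow> real" where
  "dof_functional z (Normal l m) M = dof_n z l m M"
| "dof_functional z (Tangential l m) M = dof_t z l m M"
| "dof_functional z (Corner l) M = jump z l M"

fun dof_tensor :: "vertices \<Rightarrow> dof \<Rightarrow> tensor_field" where
  "dof_tensor z (Normal j k) = N_tensor z j k"
| "dof_tensor z (Tangential j k) = T_tensor z j k"
| "dof_tensor z (Corner j) = J_tensor z j"

lemma dofs_iff [simp]:
  "Normal l m \<in> dofs \<longleftrightarrow> m \<in> {0, 1}" "Tangential l m \<in> dofs \<longleftrightarrow> m \<in> {0, 1}" "Corner l \<in> dofs"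
  by (auto simp: dofs_def)

lemma card_dofs: "finite dofs" "card dofs = 20"
proof -
  show "finite dofs"
    by (simp add: dofs_def)
  have "card (case_prod Normal ` (UNIV \<times> {0, 1})) = 8"
    "card (case_prod Tangential ` (UNIV \<times> {0, 1})) = 8" "card (range Corner) = 4"
    by (subst card_image; force simp: inj_on_def)+
  then show "card dofs = 20"
    unfolding dofs_def by (subst card_Un_disjoint; force?)+
qed

lemma basis_tensors_eq: "basis_tensors z = dof_tensor z ` dofs"
  unfolding basis_tensors_def dofs_def image_Un image_image by (auto simp: image_def)

context parallelogram_element
begin

lemma dof_tensor_in_range: "dof_tensor z i \<in> range piola"
  by (cases i) (auto simp: T_tensor_eq J_tensor_eq N_tensor_eq)

lemma dof_duality:
  assumes "i \<in> dofs" "j \<in> dofs"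
  shows "dof_functional z i (dof_tensor z j) = (if i = j then 1 else 0)"
  using assms
  by (cases i; cases j)
     (simp_all only: dofs_iff dof_functional.simps dof_tensor.simps dof.inject dof.distinct if_False
        N_dofs(1,2) N_dofs(3)[OF insertI1] T_dofs(1,2) T_dofs(3)[OF insertI1] J_dofs(1,2)
        J_dofs(3)[OF insertI1] prod.inject)

lemma linear_dof_functional:
  assumes "i \<in> dofs"
  shows "linear (\<lambda>c. dof_functional z i (piola c))"
  using assms linear_dof linear_jump by (cases i) (simp_all del: insert_iff One_nat_def)

lemma basis:
  "independent (basis_tensors z)" "span (basis_tensors z) = X_space z"
proof -
  have "DIM(coeffs) = 20"
    by (simp only: DIM_prod DIM_real)
  then have dim: "card dofs = DIM(coeffs)"
    by (simp only: card_dofs)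
  have range: "i \<in> dofs \<Longrightarrow> dof_tensor z i \<in> range piola" for i
    by (rule dof_tensor_in_range)
  show "independent (basis_tensors z)"
    unfolding basis_tensors_eq
    using dual_families(1)[where \<Phi> = piola and f = "dof_functional z",
      OF linear_piola card_dofs(1) dim range linear_dof_functional dof_duality] .
  show "span (basis_tensors z) = X_space z"
    unfolding basis_tensors_eq X_space_eq
    using dual_families(2)[where \<Phi> = piola and f = "dof_functional z",
      OF linear_piola card_dofs(1) dim range linear_dof_functional dof_duality] .
qed

end

section \<open>The norm on the reference square\<close>

lemma hat_field_continuous_on: "continuous_on S (hat_field c)"
  using hat_field_differentiable
  by (intro continuous_at_imp_continuous_on) (simp add: differentiable_imp_continuous_within)

lemma sum_tensor_fields_apply: "(\<Sum>i\<in>I. M i) p = (\<Sum>i\<in>I. M i p)" for M :: "'i \<Rightarrow> tensor_field"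
  by (induction I rule: infinite_finite_induct) simp_all

text \<open>Joint continuity in coefficients and point, for integrals depending on a parameter.\<close>

lemma continuous_hat_field_joint: "continuous_on UNIV (\<lambda>(c, p). hat_field c p)"
proof -
  have expand: "hat_field c p = (\<Sum>b\<in>Basis. (c \<bullet> b) *\<^sub>R hat_field b p)" for c p
  proof -
    have "hat_field c = hat_field (\<Sum>b\<in>Basis. (c \<bullet> b) *\<^sub>R b)"
      by (simp only: euclidean_representation)
    also have "\<dots> = (\<Sum>b\<in>Basis. (c \<bullet> b) *\<^sub>R hat_field b)"
      by (simp only: linear_sum[OF linear_hat_field] linear_cmul[OF linear_hat_field])
    finally have "hat_field c p = (\<Sum>b\<in>Basis. (c \<bullet> b) *\<^sub>R hat_field b) p"
      by simp
    also have "\<dots> = (\<Sum>b\<in>Basis. ((c \<bullet> b) *\<^sub>R hat_field b) p)"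
      by (rule sum_tensor_fields_apply)
    finally show ?thesis
      unfolding scaleR_fun_def .
  qed
  have "continuous_on UNIV (\<lambda>cp :: coeffs \<times> point. hat_field b (snd cp))" for b
    by (rule continuous_on_compose2[OF hat_field_continuous_on[of UNIV]])
       (simp_all add: continuous_on_snd continuous_on_id)
  then have "continuous_on UNIV (\<lambda>cp. \<Sum>b\<in>Basis. (fst cp \<bullet> b) *\<^sub>R hat_field b (snd cp))"
    by (intro continuous_intros)
  moreover have "(\<lambda>(c, p). hat_field c p)
      = (\<lambda>cp. \<Sum>b\<in>Basis. (fst cp \<bullet> b) *\<^sub>R hat_field b (snd cp))"
    unfolding case_prod_unfold by (rule ext, rule expand)
  ultimately show ?thesis
    by metis
qed

text \<open>The squared \<open>L\<^sub>2\<close> norm on the square, as a quadratic form in the coefficients. The closed square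
differs from the open one by a null set.\<close>

definition mass :: "coeffs \<Rightarrow> real" where
  "mass c = integral (cbox 0 1) (\<lambda>p. (norm (hat_field c p))\<^sup>2)"

lemma continuous_mass: "continuous_on UNIV mass"
  unfolding mass_def
proof (rule integral_continuous_on_param)
  show "continuous_on (UNIV \<times> cbox 0 1) (\<lambda>(c, p). (norm (hat_field c p))\<^sup>2)"
    unfolding case_prod_unfold
    by (intro continuous_on_power continuous_on_norm
        continuous_on_subset[OF continuous_hat_field_joint[unfolded case_prod_unfold]] subset_UNIV)
qed

lemma mass_scaleR: "mass (r *\<^sub>R c) = r\<^sup>2 * mass c"
  by (simp add: mass_def linear_cmul[OF linear_hat_field] scaleR_fun_def power_mult_distrib)

text \<open>Finitely many values on the square determine all coefficients; the sample points are chosen such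
that each entry reduces to polynomials in one variable.\<close>

lemma hat_field_eq_0_on_square:
  assumes "\<And>p. p \<in> cbox 0 1 \<Longrightarrow> hat_field c p = 0"
  shows "c = 0"
proof -
  obtain a0 a1 a2 a3 a4 b0 b1 b2 b3 b4 b5 c0 c1 c2 c3 c4 d1 d2 d3 d4 where c:
    "c = ((a0, a1, a2, a3, a4), (b0, b1, b2, b3, b4, b5), (c0, c1, c2, c3, c4), (d1, d2, d3, d4))"
    by (rule coeffs_cases)
  have "hat_field c (vector [x, y]) = 0" if "0 \<le> x" "x \<le> 1" "0 \<le> y" "y \<le> 1" for x y
    using assms that by (simp add: mem_box_cart forall_2)
  then have e: "hat_field c (vector [x, y]) $ i $ j = 0"
    if "0 \<le> x" "x \<le> 1" "0 \<le> y" "y \<le> 1" for x y i j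
    using that by simp
  note v = e[unfolded c hat_field.simps Let_def vector_2]
  \<comment> \<open>Entry 11: four points determine the cubic part on \<open>y = 0\<close>; the remaining terms are quadratic in
\<open>x\<close> and are determined by three points on \<open>y = 1\<close>. Entry 22 is treated likewise with \<open>x\<close> and \<open>y\<close>
exchanged.\<close>
  have 1: "a0 = 0 \<and> a1 = 0 \<and> a3 = 0 \<and> d1 = 0"
    using v[of 0 0 1 1] v[of 1 0 1 1] v[of "1/2" 0 1 1] v[of "1/4" 0 1 1]
    by (simp add: power2_eq_square power3_eq_cube)
  then have 2: "a2 = 0 \<and> a4 = 0 \<and> d2 = 0"
    using v[of 0 1 1 1] v[of 1 1 1 1] v[of "1/2" 1 1 1] by (simp add: power2_eq_square)
  have 3: "c0 = 0 \<and> c2 = 0 \<and> c4 = 0 \<and> d4 = 0"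
    using v[of 0 0 2 2] v[of 0 1 2 2] v[of 0 "1/2" 2 2] v[of 0 "1/4" 2 2]
    by (simp add: power2_eq_square power3_eq_cube)
  then have 4: "c1 = 0 \<and> c3 = 0 \<and> d3 = 0"
    using v[of 1 0 2 2] v[of 1 1 2 2] v[of 1 "1/2" 2 2] by (simp add: power2_eq_square)
  \<comment> \<open>The cubic terms of entry 12 vanish with the coefficients \<open>d\<close>, and six points determine the quadratic
rest.\<close>
  have 5: "b0 = 0 \<and> b1 = 0 \<and> b3 = 0"
    using v[of 0 0 1 2] v[of 1 0 1 2] v[of "1/2" 0 1 2] by (simp add: power2_eq_square)
  then have "b2 = 0 \<and> b5 = 0 \<and> b4 = 0"
    using 1 2 3 4 v[of 0 1 1 2] v[of 0 "1/2" 1 2] v[of 1 1 1 2] by (simp add: power2_eq_square)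
  with 1 2 3 4 5 show ?thesis
    by (simp add: c zero_prod_def)
qed

lemma mass_pos:
  assumes "c \<noteq> 0"
  shows "mass c > 0"
proof -
  have cont: "continuous_on (cbox 0 1) (\<lambda>p. (norm (hat_field c p))\<^sup>2)"
    by (intro continuous_intros hat_field_continuous_on)
  have "mass c \<ge> 0"
    unfolding mass_def by (rule integral_nonneg[OF integrable_continuous[OF cont]]) simp
  moreover have "mass c \<noteq> 0"
  proof
    assume "mass c = 0"
    have "vector [1 / 2, 1 / 2] \<in> box (0 :: point) 1"
      by (simp add: mem_box_cart forall_2)
    then have "box (0 :: point) 1 \<noteq> {}"
      by blast
    then have "\<forall>p\<in>cbox 0 1. (norm (hat_field c p))\<^sup>2 = 0"
      using integral_cbox_eq_0_iff[OF cont] \<open>mass c = 0\<close> by (simp add: mass_def)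
    then have "c = 0"
      by (intro hat_field_eq_0_on_square) simp
    with assms show False ..
  qed
  ultimately show ?thesis
    by simp
qed

text \<open>A positive continuous function that is homogeneous of degree two is comparable to the squared norm,
with its extrema on the unit sphere as constants.\<close>

lemma mass_equiv_norm:
  obtains q Q where "q > 0" "Q > 0" "\<And>c. q * (norm c)\<^sup>2 \<le> mass c" "\<And>c. mass c \<le> Q * (norm c)\<^sup>2"
proof -
  have ne: "sphere (0 :: coeffs) 1 \<noteq> {}"
    by (simp add: sphere_eq_empty)
  have cont: "continuous_on (sphere 0 1) mass"
    using continuous_mass continuous_on_subset by blast
  obtain c1 where c1: "c1 \<in> sphere 0 1" "\<And>c. c \<in> sphere 0 1 \<Longrightarrow> mass c1 \<le> mass c"
    using continuous_attains_inf[OF compact_sphere ne cont] by blast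
  obtain c2 where c2: "c2 \<in> sphere 0 1" "\<And>c. c \<in> sphere 0 1 \<Longrightarrow> mass c \<le> mass c2"
    using continuous_attains_sup[OF compact_sphere ne cont] by blast
  have "mass c1 * (norm c)\<^sup>2 \<le> mass c \<and> mass c \<le> mass c2 * (norm c)\<^sup>2" for c
  proof (cases "c = 0")
    case True
    then show ?thesis
      using mass_scaleR[of 0 0] by simp
  next
    case False
    let ?u = "(1 / norm c) *\<^sub>R c"
    have u: "?u \<in> sphere 0 1"
      using False by simp
    have "mass c = (norm c)\<^sup>2 * mass ?u"
      using False by (simp add: mass_scaleR power_divide)
    with c1(2)[OF u] c2(2)[OF u] show ?thesis
      by (metis mult.commute mult_left_mono zero_le_power2)
  qed
  moreover have "mass c1 > 0" "mass c2 > 0"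
    using c1(1) c2(1) by (auto intro!: mass_pos)
  ultimately show ?thesis
    using that by blast
qed

section \<open>Shape regularity and the scaling of the norm\<close>

lemma norm_matrix_sq: "(norm (A :: real ^ 2 ^ 2))\<^sup>2
   = (A $ 1 $ 1)\<^sup>2 + (A $ 1 $ 2)\<^sup>2 + ((A $ 2 $ 1)\<^sup>2 + (A $ 2 $ 2)\<^sup>2)"
  by (simp add: norm_vec_def L2_set_def sum_2)

lemma norm_matrix_mult: "norm (A ** X) \<le> norm A * norm X" for A X :: "real ^ 2 ^ 2"
proof -
  have cs: "(a * b + c * d)\<^sup>2 \<le> (a\<^sup>2 + c\<^sup>2) * (b\<^sup>2 + d\<^sup>2)" for a b c d :: real
  proof -
    have "(a\<^sup>2 + c\<^sup>2) * (b\<^sup>2 + d\<^sup>2) - (a * b + c * d)\<^sup>2 = (a * d - b * c)\<^sup>2"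
      by (simp add: algebra_simps power2_eq_square)
    then show ?thesis
      by (metis diff_ge_0_iff_ge zero_le_power2)
  qed
  have "(norm (A ** X))\<^sup>2 \<le> (norm A * norm X)\<^sup>2"
    using cs[of "A $ 1 $ 1" "X $ 1 $ 1" "A $ 1 $ 2" "X $ 2 $ 1"]
      cs[of "A $ 1 $ 1" "X $ 1 $ 2" "A $ 1 $ 2" "X $ 2 $ 2"]
      cs[of "A $ 2 $ 1" "X $ 1 $ 1" "A $ 2 $ 2" "X $ 2 $ 1"]
      cs[of "A $ 2 $ 1" "X $ 1 $ 2" "A $ 2 $ 2" "X $ 2 $ 2"]
    unfolding power_mult_distrib norm_matrix_sq
    by (simp add: matrix_matrix_mult_def sum_2 algebra_simps)
  then show ?thesis
    by (rule power2_le_imp_le) simp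
qed

lemma norm_transpose [simp]: "norm (transpose A) = norm A" for A :: "real ^ 2 ^ 2"
  by (rule power2_eq_imp_eq) (simp_all add: norm_matrix_sq transpose_def)

lemma norm_congruence_le: "norm (A ** X ** transpose A) \<le> (norm A)\<^sup>2 * norm X"
  for A X :: "real ^ 2 ^ 2"
proof -
  have "norm (A ** X ** transpose A) \<le> norm (A ** X) * norm A"
    using norm_matrix_mult[of "A ** X" "transpose A"] by simp
  also have "\<dots> \<le> (norm A * norm X) * norm A"
    by (intro mult_right_mono norm_matrix_mult) simp
  finally show ?thesis
    by (simp add: power2_eq_square algebra_simps)
qed

text \<open>The upper bound \<open>norm_congruence_le\<close> for the adjugate matrix, whose Frobenius norm is that of \<open>A\<close>
in dimension two.\<close>

lemma norm_congruence_ge: "(det A)\<^sup>2 * norm X \<le> (norm A)\<^sup>2 * norm (A ** X ** transpose A)"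
  for A X :: "real ^ 2 ^ 2"
proof -
  \<comment> \<open>The adjugate matrix.\<close>
  define A' :: "real ^ 2 ^ 2"
    where "A' = vector [vector [A $ 2 $ 2, - (A $ 1 $ 2)], vector [- (A $ 2 $ 1), A $ 1 $ 1]]"
  have "A' ** (A ** X ** transpose A) ** transpose A' = (det A)\<^sup>2 *\<^sub>R X"
    by (simp add: A'_def vec_eq_iff forall_2 matrix_matrix_mult_def transpose_def sum_2 det_2
        power2_eq_square algebra_simps)
  moreover have "norm A' = norm A"
    by (rule power2_eq_imp_eq) (simp_all add: norm_matrix_sq A'_def)
  ultimately show ?thesis
    using norm_congruence_le[of A' "A ** X ** transpose A"] by simp
qed

context parallelogram_element
begin

lemma norm_normal: "norm (normal z l) = 1"
proof -
  have "norm (tangent z l) = 1"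
    using edge_len_pos[of l] by (simp add: tangent_eq edge_len_eq)
  moreover have "norm (normal z l) = norm (tangent z l)"
    by (simp add: normal_def norm_vec_def L2_set_def sum_2 add.commute)
  ultimately show ?thesis
    by simp
qed

lemma F_diff: "F p - F q = B *v (p - q)"
  by (simp add: F_map_def matrix_vector_mult_diff_distrib)

lemma continuous_F: "continuous_on S F"
  unfolding F_map_def[abs_def]
  by (intro continuous_intros bounded_linear.continuous_on[OF matrix_vector_mul_bounded_linear])

lemma element_subset: "element z \<subseteq> F ` cbox 0 1"
  unfolding element_def using box_subset_cbox by (rule image_mono)

lemma bounded_element: "bounded (element z)"
  using compact_imp_bounded[OF compact_continuous_image[OF continuous_F compact_cbox]]
    element_subset bounded_subset by blast

lemma vertex_in_closure: "z j \<in> closure (element z)"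
proof -
  have "vector [1 / 2, 1 / 2] \<in> box (0 :: point) 1"
    by (simp add: mem_box_cart forall_2)
  then have "closure (box (0 :: point) 1) = cbox 0 1"
    by (intro closure_box) blast
  then have "F ` cbox 0 1 \<subseteq> closure (element z)"
    unfolding element_def using closure_subset
    by (metis continuous_F image_closure_subset closed_closure)
  moreover have "ref_vertex j \<in> cbox 0 1"
    by (cases j rule: exhaust_four) (simp_all add: mem_box_cart forall_2)
  ultimately show ?thesis
    unfolding vertex_eq[of j] by blast
qed

lemma edge_len_le_diameter: "edge_len z l \<le> diameter (element z)"
  unfolding edge_len_def
  using diameter_bounded_bound[OF bounded_closure[OF bounded_element] vertex_in_closure vertex_in_closure]
  by (simp add: diameter_closure[OF bounded_element])

lemma diameter_pos: "diameter (element z) > 0"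
  using edge_len_le_diameter[of 1] edge_len_pos[of 1] by linarith

lemma normal_ref_eq: "normal ref_vertex l = - tangent ref_vertex (l + 1)"
  by (cases l rule: exhaust_four)
     (simp_all add: tangent_ref normal_ref cyclic_five vec_eq_iff forall_2)

lemma norm_B_normal: "norm (B *v normal ref_vertex l) = edge_len z (l + 1)"
proof -
  have "B *v (- v) = - (B *v v)" for v
    using matrix_vector_mult_diff_distrib[of B 0 v] by simp
  then show ?thesis
    by (simp add: normal_ref_eq edge_len_eq)
qed

lemma normal_inner_B: "normal z l \<bullet> (B *v v) = det B / edge_len z l * (normal ref_vertex l \<bullet> v)"
  by (simp add: inner_matrix_transpose[of _ B] transpose_B_normal del: transpose_matrix_vector)

text \<open>The height of the parallelogram over an edge does not exceed the adjacent edge.\<close>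

lemma det_le: "det B \<le> edge_len z l * edge_len z (l + 1)"
proof -
  have "normal ref_vertex l \<bullet> normal ref_vertex l = 1"
    by (cases l rule: exhaust_four) (simp_all add: normal_ref inner_vec_def sum_2)
  then have "det B / edge_len z l = normal z l \<bullet> (B *v normal ref_vertex l)"
    by (simp add: normal_inner_B)
  also have "\<dots> \<le> norm (normal z l) * norm (B *v normal ref_vertex l)"
    by (rule norm_cauchy_schwarz)
  finally show ?thesis
    using edge_len_pos[of l] by (simp add: norm_normal norm_B_normal field_simps)
qed

lemma B_norm_sq: "(norm B)\<^sup>2 = (edge_len z 1)\<^sup>2 + (edge_len z 2)\<^sup>2"
  unfolding norm_matrix_sq edge_len_eq power2_norm_eq_inner tangent_ref
  by (simp add: inner_vec_def sum_2 matrix_vector_mult_def power2_eq_square)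

lemma diameter_le_edges: "diameter (element z) \<le> edge_len z 1 + edge_len z 2"
proof (rule diameter_le)
  show "element z \<noteq> {} \<or> 0 \<le> edge_len z 1 + edge_len z 2"
    using edge_len_pos[of 1] edge_len_pos[of 2] by simp
  fix x y
  assume "x \<in> element z" "y \<in> element z"
  then obtain p q where p: "p \<in> cbox 0 1" "x = F p" and q: "q \<in> cbox 0 1" "y = F q"
    using element_subset by blast
  have bound: "\<bar>p $ i - q $ i\<bar> \<le> 1" for i
    using p(1) q(1) by (auto simp: mem_box_cart abs_le_iff) (smt (verit))+
  have "x - y = (p $ 1 - q $ 1) *\<^sub>R (B *v tangent ref_vertex 1)
      + (p $ 2 - q $ 2) *\<^sub>R (B *v tangent ref_vertex 2)"
    unfolding p(2) q(2) F_diff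
    by (simp add: tangent_ref vec_eq_iff forall_2 matrix_vector_mult_def sum_2)
  also have "norm \<dots> \<le> \<bar>p $ 1 - q $ 1\<bar> * edge_len z 1 + \<bar>p $ 2 - q $ 2\<bar> * edge_len z 2"
    by (rule order_trans[OF norm_triangle_ineq]) (simp add: edge_len_eq)
  also have "\<dots> \<le> 1 * edge_len z 1 + 1 * edge_len z 2"
    using edge_len_pos[of 1] edge_len_pos[of 2] by (intro add_mono mult_right_mono bound) auto
  finally show "norm (x - y) \<le> edge_len z 1 + edge_len z 2"
    by simp
qed

text \<open>The diameter of an inscribed disc does not exceed the height over \<open>E\<^sub>l\<close>, which is
\<open>det B / e\<^sub>l\<close>.\<close>

lemma inscribed_ball:
  assumes "ball c r \<subseteq> element z"
  shows "2 * r * edge_len z l \<le> det B"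
proof -
  have "2 * r \<le> det B / edge_len z l"
  proof (cases "r > 0")
    case True
    show ?thesis
    proof (rule dense_le_bounded[of 0])
      fix d :: real
      assume d: "0 < d" "d < 2 * r"
      \<comment> \<open>Two points of the disc at distance \<open>d\<close> in normal direction; in reference coordinates their distance
in that direction is at most 1.\<close>
      let ?n = "normal z l"
      have "c + (d / 2) *\<^sub>R ?n \<in> ball c r" "c - (d / 2) *\<^sub>R ?n \<in> ball c r"
        using d by (simp_all add: dist_norm norm_normal)
      then obtain p q where p: "p \<in> cbox 0 1" "c + (d / 2) *\<^sub>R ?n = F p"
        and q: "q \<in> cbox 0 1" "c - (d / 2) *\<^sub>R ?n = F q"
        using assms element_subset by blast
      have "F p - F q = d *\<^sub>R ?n"
        unfolding p(2)[symmetric] q(2)[symmetric] by (simp add: scaleR_left.add[symmetric])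
      then have "d = ?n \<bullet> (B *v (p - q))"
        unfolding F_diff[symmetric] using norm_normal[of l] by (simp add: dot_square_norm)
      also have "\<dots> = det B / edge_len z l * (normal ref_vertex l \<bullet> (p - q))"
        by (rule normal_inner_B)
      also have "\<dots> \<le> det B / edge_len z l * 1"
      proof (rule mult_left_mono)
        show "normal ref_vertex l \<bullet> (p - q) \<le> 1"
          using p(1) q(1)
          by (cases l rule: exhaust_four)
             (simp_all add: normal_ref inner_vec_def sum_2 mem_box_cart forall_2)
        show "0 \<le> det B / edge_len z l"
          using det_pos edge_len_pos[of l] by simp
      qed
      finally show "d \<le> det B / edge_len z l"
        by simp
    qed (use True in simp)
  next
    case False
    then show ?thesis
      using det_pos edge_len_pos[of l] by (smt (verit) divide_nonneg_pos)
  qed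
  then show ?thesis
    using edge_len_pos[of l] by (simp add: field_simps)
qed

text \<open>The diameter is at most the sum of two edges, and each edge times the diameter of an inscribed disc
is at most the area.\<close>

lemma shape_regular_det:
  assumes "shape_regular \<sigma> z" "\<sigma> > 0"
  shows "(diameter (element z))\<^sup>2 \<le> 2 * \<sigma> * det B"
proof -
  let ?h = "diameter (element z)"
  obtain c r where r: "ball c r \<subseteq> element z" "?h \<le> \<sigma> * (2 * r)"
    using assms(1) by (auto simp: shape_regular_def)
  have "?h\<^sup>2 \<le> (\<sigma> * (2 * r)) * (edge_len z 1 + edge_len z 2)"
    unfolding power2_eq_square using r(2) diameter_le_edges diameter_pos
    by (intro mult_mono) auto
  also have "\<dots> = \<sigma> * (2 * r * edge_len z 1 + 2 * r * edge_len z 2)"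
    by (simp add: algebra_simps)
  also have "\<dots> \<le> \<sigma> * (det B + det B)"
    using assms(2) by (intro mult_left_mono add_mono inscribed_ball[OF r(1)]) auto
  finally show ?thesis
    by simp
qed

lemma element_integral:
  assumes "continuous_on UNIV (\<lambda>p. g (F p) :: real)"
  shows "integral (element z) g = det B * integral (cbox 0 1) (\<lambda>p. g (F p))"
proof -
  \<comment> \<open>The change of variables is applied to the integrand as a vector with one component.\<close>
  define G :: "point \<Rightarrow> real ^ 1" where "G x = vec (g x)" for x
  have cont: "continuous_on S (\<lambda>p. G (F p))" for S
    unfolding G_def using continuous_on_subset[OF assms, of S]
    by (simp add: continuous_on_vec_lambda vec_def)
  have D: "(F has_derivative (\<lambda>h. B *v h)) (at p within box 0 1)" for p
    unfolding F_map_def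
    by (rule has_derivative_eq_rhs,
        rule has_derivative_add[OF bounded_linear_imp_has_derivative has_derivative_const]) simp_all
  have abs: "(\<lambda>p. \<bar>det (matrix (\<lambda>h. B *v h))\<bar> *\<^sub>R G (F p)) absolutely_integrable_on box 0 1"
    unfolding absolutely_integrable_on_open_interval
    by (intro absolutely_integrable_continuous continuous_intros cont)
  have "inj_on F (box 0 1)"
    by (metis inj_on_def inv_F)
  have "G absolutely_integrable_on element z \<and>
    integral (element z) G = integral (box 0 1) (\<lambda>p. \<bar>det (matrix (\<lambda>h. B *v h))\<bar> *\<^sub>R G (F p))"
    unfolding element_def
    by (rule has_absolute_integral_change_of_variables[where g = F and f = G, OF _ D
        \<open>inj_on F (box 0 1)\<close>, THEN iffD1, OF _ conjI[OF abs refl]]) simp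
  moreover have "integral (box 0 1) (\<lambda>p. \<bar>det (matrix (\<lambda>h. B *v h))\<bar> *\<^sub>R G (F p))
      = det B *\<^sub>R integral (cbox 0 1) (\<lambda>p. G (F p))"
    using det_pos by (simp add: integral_open_interval)
  moreover have "integral S (\<lambda>x. g (f x)) = integral S (\<lambda>x. G (f x)) $ 1"
    if "(\<lambda>x. G (f x)) integrable_on S" for S and f :: "point \<Rightarrow> point"
    using integral_component_eq_cart[OF that, of 1] by (simp add: G_def)
  from this[of "\<lambda>x. x"] this[of F]
  have "G absolutely_integrable_on element z \<Longrightarrow> integral (element z) g = integral (element z) G $ 1"
    "integral (cbox 0 1) (\<lambda>p. g (F p)) = integral (cbox 0 1) (\<lambda>p. G (F p)) $ 1"
    using integrable_continuous[OF cont] by (simp_all add: absolutely_integrable_on_def)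
  ultimately show ?thesis
    by simp
qed

text \<open>The integral picks up the factor \<open>det B\<close>, the integrand the factor \<open>det B ^ (-2)\<close> and the
congruence by \<open>B\<close>, which changes norms by at most \<open>|B|\<^sup>2\<close> and at least \<open>(det B)\<^sup>2 / |B|\<^sup>2\<close>.\<close>

lemma L2_norm_piola:
  "(L2_norm_on (element z) (piola c))\<^sup>2 \<le> (norm B) ^ 4 / det B * mass c"
  "(det B) ^ 3 / (norm B) ^ 4 * mass c \<le> (L2_norm_on (element z) (piola c))\<^sup>2"
proof -
  have eq: "piola c (F p) = (1 / det B) *\<^sub>R (B ** hat_field c p ** transpose B)" for p
    by (simp add: piola_def PK_def)
  have cont: "continuous_on S (\<lambda>p. (norm (piola c (F p)))\<^sup>2)" for S
    unfolding eq
    by (intro continuous_intros bounded_linear.continuous_on[OF bounded_linear_congruence]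
        hat_field_continuous_on)
  have cont': "continuous_on S (\<lambda>p. k * (norm (hat_field c p))\<^sup>2)" for S and k :: real
    by (intro continuous_intros hat_field_continuous_on)
  let ?I = "integral (cbox 0 1) (\<lambda>p. (norm (piola c (F p)))\<^sup>2)"
  have "?I \<ge> 0"
    by (intro integral_nonneg integrable_continuous cont) simp
  then have L2: "(L2_norm_on (element z) (piola c))\<^sup>2 = det B * ?I"
    using det_pos unfolding L2_norm_on_def element_integral[OF cont] by simp
  have B: "norm B > 0"
    using det_pos by (auto simp: det_2)
  have upper: "(norm (piola c (F p)))\<^sup>2 \<le> (norm B) ^ 4 / (det B)\<^sup>2 * (norm (hat_field c p))\<^sup>2" for p
  proof -
    have "norm (piola c (F p)) \<le> 1 / det B * ((norm B)\<^sup>2 * norm (hat_field c p))"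
      unfolding eq using det_pos norm_congruence_le[of B "hat_field c p"]
      by (simp add: divide_right_mono)
    then have "(norm (piola c (F p)))\<^sup>2 \<le> (1 / det B * ((norm B)\<^sup>2 * norm (hat_field c p)))\<^sup>2"
      by (rule power_mono) simp
    then show ?thesis
      by (simp add: power_mult_distrib power_divide)
  qed
  have lower: "(det B)\<^sup>2 / (norm B) ^ 4 * (norm (hat_field c p))\<^sup>2 \<le> (norm (piola c (F p)))\<^sup>2" for p
  proof -
    have "det B / (norm B)\<^sup>2 * norm (hat_field c p) \<le> norm (piola c (F p))"
      unfolding eq using det_pos B norm_congruence_ge[of B "hat_field c p"]
      by (simp add: field_simps power2_eq_square)
    then have "(det B / (norm B)\<^sup>2 * norm (hat_field c p))\<^sup>2 \<le> (norm (piola c (F p)))\<^sup>2"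
      using det_pos by (intro power_mono) auto
    then show ?thesis
      by (simp add: power_mult_distrib power_divide)
  qed
  have "?I \<le> (norm B) ^ 4 / (det B)\<^sup>2 * mass c"
    unfolding mass_def integral_mult_right[symmetric]
    by (intro integral_le integrable_continuous cont cont' upper)
  then have "det B * ?I \<le> det B * ((norm B) ^ 4 / (det B)\<^sup>2 * mass c)"
    using det_pos by (intro mult_left_mono) auto
  moreover have "det B * ((norm B) ^ 4 / (det B)\<^sup>2 * mass c) = (norm B) ^ 4 / det B * mass c"
    using det_pos by (simp add: power2_eq_square)
  ultimately show "(L2_norm_on (element z) (piola c))\<^sup>2 \<le> (norm B) ^ 4 / det B * mass c"
    by (simp only: L2)
  have "(det B)\<^sup>2 / (norm B) ^ 4 * mass c \<le> ?I"
    unfolding mass_def integral_mult_right[symmetric]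
    by (intro integral_le integrable_continuous cont cont' lower)
  then have "det B * ((det B)\<^sup>2 / (norm B) ^ 4 * mass c) \<le> det B * ?I"
    using det_pos by (intro mult_left_mono) auto
  moreover have "det B * ((det B)\<^sup>2 / (norm B) ^ 4 * mass c) = (det B) ^ 3 / (norm B) ^ 4 * mass c"
    by (simp add: power2_eq_square power3_eq_cube)
  ultimately show "(det B) ^ 3 / (norm B) ^ 4 * mass c \<le> (L2_norm_on (element z) (piola c))\<^sup>2"
    by (simp only: L2)
qed

end

context parallelogram_element
begin

text \<open>All edges have lengths between \<open>det B / h\<close> and \<open>h\<close>, and \<open>h\<^sup>2 \<le> 2 \<sigma> det B\<close>.\<close>

lemma shape_regular_estimates:
  assumes reg: "shape_regular \<sigma> z" and \<sigma>: "\<sigma> > 0"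
  shows "(edge_len z l)\<^sup>2 / det B \<le> 2 * \<sigma>" "1 / (2 * \<sigma>) \<le> (edge_len z l)\<^sup>2 / det B"
    and "\<bar>shear l\<bar> \<le> 2 * \<sigma>"
proof -
  let ?h = "diameter (element z)" and ?e = "edge_len z l" and ?f = "edge_len z (l + 1)"
  note h = diameter_pos and e = edge_len_pos[of l] edge_len_le_diameter[of l]
    and f = edge_len_pos[of "l + 1"] edge_len_le_diameter[of "l + 1"]
  note d = det_pos det_le[of l] shape_regular_det[OF assms]
  have "?e\<^sup>2 \<le> ?h\<^sup>2"
    using e by (intro power_mono) auto
  then show "?e\<^sup>2 / det B \<le> 2 * \<sigma>"
    using d(1,3) by (simp add: pos_divide_le_eq)
  have "?f\<^sup>2 \<le> ?h\<^sup>2"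
    using f by (intro power_mono) auto
  have "det B * det B \<le> (?e * ?f) * (?e * ?f)"
    using d(1,2) by (intro mult_mono) auto
  also have "\<dots> = ?e\<^sup>2 * ?f\<^sup>2"
    by (simp add: power2_eq_square)
  also have "\<dots> \<le> ?e\<^sup>2 * (2 * \<sigma> * det B)"
    using \<open>?f\<^sup>2 \<le> ?h\<^sup>2\<close> d(3) by (intro mult_left_mono) auto
  finally have "det B * det B \<le> (?e\<^sup>2 * (2 * \<sigma>)) * det B"
    by (simp add: mult.assoc)
  then have "det B \<le> ?e\<^sup>2 * (2 * \<sigma>)"
    using d(1) by (simp only: mult_le_cancel_right_pos)
  then show "1 / (2 * \<sigma>) \<le> ?e\<^sup>2 / det B"
    using d(1) \<sigma> by (simp add: field_simps)
  have "\<bar>shear l\<bar> \<le> ?e * ?f / ?e\<^sup>2"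
    unfolding shear_def abs_divide abs_power2
    using Cauchy_Schwarz_ineq2[of "B *v tangent ref_vertex l" "B *v normal ref_vertex l"]
    by (intro divide_right_mono) (simp_all add: edge_len_eq[symmetric] norm_B_normal)
  also have "\<dots> = ?f / ?e"
    using e by (simp add: power2_eq_square)
  also have "\<dots> \<le> 2 * \<sigma>"
  proof -
    have "?f * det B \<le> ?f * (?e * ?f)"
      using d(2) f by (intro mult_left_mono) auto
    also have "\<dots> = ?e * ?f\<^sup>2"
      by (simp add: power2_eq_square)
    also have "\<dots> \<le> ?e * (2 * \<sigma> * det B)"
      using \<open>?f\<^sup>2 \<le> ?h\<^sup>2\<close> d(3) e by (intro mult_left_mono) auto
    finally have "?f * det B \<le> (?e * (2 * \<sigma>)) * det B"
      by (simp add: mult.assoc)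
    then have "?f \<le> ?e * (2 * \<sigma>)"
      using d(1) by (simp only: mult_le_cancel_right_pos)
    then show ?thesis
      using e by (simp add: pos_divide_le_eq mult.commute)
  qed
  finally show "\<bar>shear l\<bar> \<le> 2 * \<sigma>" .
qed

text \<open>Shape regularity inserted into \<open>L2_norm_piola\<close>: \<open>|B|\<^sup>2 \<le> 2 h\<^sup>2\<close> and
\<open>det B \<ge> h\<^sup>2 / (2 \<sigma>)\<close>.\<close>

lemma L2_norm_piola_scaling:
  assumes reg: "shape_regular \<sigma> z" and \<sigma>: "\<sigma> > 0"
  defines "h \<equiv> diameter (element z)"
  shows "L2_norm_on (element z) (piola c) \<le> sqrt (8 * \<sigma> * mass c) * h"
    and "sqrt (mass c / (32 * \<sigma> ^ 3)) * h \<le> L2_norm_on (element z) (piola c)"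
proof -
  have mass: "mass c \<ge> 0"
    using mass_pos[of c] mass_scaleR[of 0 0] by (cases "c = 0") auto
  have h: "h > 0"
    using diameter_pos by (simp add: h_def)
  have nonneg: "L2_norm_on (element z) (piola c) \<ge> 0"
  proof -
    let ?f = "\<lambda>x. (norm (piola c x))\<^sup>2"
    have "integral (element z) ?f \<ge> 0"
      by (cases "?f integrable_on element z") (simp_all add: integral_nonneg not_integrable_integral)
    then show ?thesis
      by (simp add: L2_norm_on_def)
  qed
  have det: "h\<^sup>2 / (2 * \<sigma>) \<le> det B"
    using shape_regular_det[OF reg \<sigma>] \<sigma> by (simp add: h_def field_simps)
  have "(edge_len z l)\<^sup>2 \<le> h\<^sup>2" for l
    using edge_len_le_diameter[of l] edge_len_pos[of l] by (auto simp: h_def intro!: power_mono)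
  then have "(norm B)\<^sup>2 \<le> 2 * h\<^sup>2"
    unfolding B_norm_sq by (metis add_mono mult_2)
  then have "((norm B)\<^sup>2)\<^sup>2 \<le> (2 * h\<^sup>2)\<^sup>2"
    by (rule power_mono) simp
  then have B4: "(norm B) ^ 4 \<le> 4 * h ^ 4"
    by (simp add: power_mult_distrib flip: power_mult)
  have B4pos: "(norm B) ^ 4 > 0"
    using det_pos by (auto simp: det_2)
  have "(L2_norm_on (element z) (piola c))\<^sup>2 \<le> (norm B) ^ 4 / det B * mass c"
    by (rule L2_norm_piola)
  also have "\<dots> \<le> (4 * h ^ 4) / (h\<^sup>2 / (2 * \<sigma>)) * mass c"
    using B4 det det_pos h \<sigma> mass by (intro mult_right_mono frac_le) auto
  also have "\<dots> = (sqrt (8 * \<sigma> * mass c) * h)\<^sup>2"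
    using h \<sigma> mass by (simp add: power_mult_distrib field_simps eval_nat_numeral)
  finally show "L2_norm_on (element z) (piola c) \<le> sqrt (8 * \<sigma> * mass c) * h"
    by (rule power2_le_imp_le) (use h \<sigma> mass in simp)
  have "(sqrt (mass c / (32 * \<sigma> ^ 3)) * h)\<^sup>2 = (h\<^sup>2 / (2 * \<sigma>)) ^ 3 / (4 * h ^ 4) * mass c"
    using h \<sigma> mass by (simp add: power_mult_distrib field_simps eval_nat_numeral)
  also have "\<dots> \<le> (det B) ^ 3 / (norm B) ^ 4 * mass c"
    using B4 B4pos det det_pos h \<sigma> mass by (intro mult_right_mono frac_le power_mono) auto
  also have "\<dots> \<le> (L2_norm_on (element z) (piola c))\<^sup>2"
    by (rule L2_norm_piola)
  finally show "sqrt (mass c / (32 * \<sigma> ^ 3)) * h \<le> L2_norm_on (element z) (piola c)"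
    by (rule power2_le_imp_le) (rule nonneg)
qed

lemma dof_t_piola_bound:
  assumes reg: "shape_regular \<sigma> z" and \<sigma>: "\<sigma> > 0" and m: "m \<in> {0, 1}"
  shows "\<bar>dof_t z l m (piola c)\<bar> \<le>
    \<bar>(tr_t ref_vertex l (hat_field c) (ref_vertex l)
        + tr_t ref_vertex l (hat_field c) (ref_vertex (l + 1))) / 2\<bar>
    + \<bar>(tr_t ref_vertex l (hat_field c) (ref_vertex (l + 1))
        - tr_t ref_vertex l (hat_field c) (ref_vertex l)) / 6\<bar>
    + 2 * \<sigma> * \<bar>tr_n ref_vertex l (hat_field c) (ref_vertex (l + 1))
       - tr_n ref_vertex l (hat_field c) (ref_vertex l)\<bar>" (is "_ \<le> ?b")
proof -
  have shear: "\<bar>shear l * d\<bar> \<le> 2 * \<sigma> * \<bar>d\<bar>" for d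
    unfolding abs_mult by (intro mult_right_mono shape_regular_estimates(3)[OF reg \<sigma>]) simp
  have mean: "\<bar>a + x\<bar> \<le> \<bar>a\<bar> + \<bar>b\<bar> + y" and slope: "\<bar>b\<bar> \<le> \<bar>a\<bar> + \<bar>b\<bar> + y"
    if "\<bar>x\<bar> \<le> y" for a b x y :: real
    using that abs_triangle_ineq[of a x] by auto
  have "\<bar>dof_t z l 0 (piola c)\<bar> \<le> ?b" "\<bar>dof_t z l 1 (piola c)\<bar> \<le> ?b"
    unfolding dof_t_piola by (rule mean[OF shear] slope[OF shear])+
  then show ?thesis
    using m by blast
qed

lemma jump_piola_bound:
  assumes reg: "shape_regular \<sigma> z" and \<sigma>: "\<sigma> > 0"
  shows "\<bar>jump z l (piola c)\<bar> \<le>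
    \<bar>tn_comp ref_vertex (l - 1) (hat_field c) (ref_vertex l)
     - tn_comp ref_vertex l (hat_field c) (ref_vertex l)\<bar>
    + 2 * \<sigma> * \<bar>tr_n ref_vertex (l - 1) (hat_field c) (ref_vertex l)\<bar>
    + 2 * \<sigma> * \<bar>tr_n ref_vertex l (hat_field c) (ref_vertex l)\<bar>"
proof -
  have "\<bar>shear i * d\<bar> \<le> 2 * \<sigma> * \<bar>d\<bar>" for i d
    unfolding abs_mult by (intro mult_right_mono shape_regular_estimates(3)[OF reg \<sigma>]) simp
  from this[of "l - 1" "tr_n ref_vertex (l - 1) (hat_field c) (ref_vertex l)"]
    this[of l "tr_n ref_vertex l (hat_field c) (ref_vertex l)"]
  show ?thesis
    unfolding jump_piola by linarith
qed

lemma linear_functional_N_tilde: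
  assumes "linear (\<lambda>c. f (piola c) :: real)"
  shows "f (N_tilde z j k) = (edge_len z j)\<^sup>2 / det B * f (piola (N_tilde_coeffs j k))"
  unfolding N_tilde_eq linear_cmul[OF assms] by simp

end

section \<open>Uniform bounds for the basis\<close>

text \<open>The coefficients are those of a fixed field, scaled by \<open>e\<^sub>j\<^sup>2 / det B\<close>, and corrections weighted
by its degrees of freedom, which depend on the element only through that factor and the shears.\<close>

lemma N_coeffs_upper:
  assumes \<sigma>: "\<sigma> > 0"
  shows "\<exists>K. \<forall>z. parallelogram z \<and> shape_regular \<sigma> z \<longrightarrow> norm (parallelogram_element.N_coeffs z j k) \<le> K"
proof -
  let ?c = "N_tilde_coeffs j k"
  define t where "t l = \<bar>(tr_t ref_vertex l (hat_field ?c) (ref_vertex l)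
        + tr_t ref_vertex l (hat_field ?c) (ref_vertex (l + 1))) / 2\<bar>
    + \<bar>(tr_t ref_vertex l (hat_field ?c) (ref_vertex (l + 1))
        - tr_t ref_vertex l (hat_field ?c) (ref_vertex l)) / 6\<bar>
    + 2 * \<sigma> * \<bar>tr_n ref_vertex l (hat_field ?c) (ref_vertex (l + 1))
       - tr_n ref_vertex l (hat_field ?c) (ref_vertex l)\<bar>" for l
  define s where "s l = \<bar>tn_comp ref_vertex (l - 1) (hat_field ?c) (ref_vertex l)
     - tn_comp ref_vertex l (hat_field ?c) (ref_vertex l)\<bar>
    + 2 * \<sigma> * \<bar>tr_n ref_vertex (l - 1) (hat_field ?c) (ref_vertex l)\<bar>
    + 2 * \<sigma> * \<bar>tr_n ref_vertex l (hat_field ?c) (ref_vertex l)\<bar>" for l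
  let ?K = "2 * \<sigma> * norm ?c + (\<Sum>l\<in>UNIV. \<Sum>m\<in>{0, 1}. 2 * \<sigma> * t l * norm (T_coeffs l m))
    + (\<Sum>l\<in>UNIV. 2 * \<sigma> * s l * norm (J_coeffs l))"
  have "norm (parallelogram_element.N_coeffs z j k) \<le> ?K" if z: "parallelogram z" "shape_regular \<sigma> z" for z
  proof -
    interpret parallelogram_element z
      by standard (rule z)
    let ?a = "(edge_len z j)\<^sup>2 / det B"
    have a: "0 \<le> ?a" "?a \<le> 2 * \<sigma>"
      using det_pos shape_regular_estimates(1)[OF z(2) \<sigma>] by simp_all
    have scaled: "\<bar>?a * x\<bar> \<le> 2 * \<sigma> * y" if "\<bar>x\<bar> \<le> y" for x y
      unfolding abs_mult using a that \<sigma> by (intro mult_mono) auto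
    have dt: "\<bar>dof_t z l m (N_tilde z j k)\<bar> \<le> 2 * \<sigma> * t l" if "m \<in> {0, 1}" for l m
      unfolding linear_functional_N_tilde[OF linear_dof(2)[OF that]] t_def
      by (intro scaled dof_t_piola_bound z \<sigma> that)
    have js: "\<bar>jump z l (N_tilde z j k)\<bar> \<le> 2 * \<sigma> * s l" for l
      unfolding linear_functional_N_tilde[OF linear_jump] s_def
      by (intro scaled jump_piola_bound z \<sigma>)
    have "norm (N_coeffs j k) \<le> norm (?a *\<^sub>R ?c)
       + norm (\<Sum>l\<in>UNIV. \<Sum>m\<in>{0, 1}. dof_t z l m (N_tilde z j k) *\<^sub>R T_coeffs l m)
       + norm (\<Sum>l\<in>UNIV. jump z l (N_tilde z j k) *\<^sub>R J_coeffs l)"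
      unfolding N_coeffs_def by (intro order_trans[OF norm_triangle_ineq4] add_right_mono norm_triangle_ineq4)
    also have "\<dots> \<le> ?K"
    proof (intro add_mono)
      show "norm (?a *\<^sub>R ?c) \<le> 2 * \<sigma> * norm ?c"
        using a by (simp only: norm_scaleR abs_of_nonneg mult_right_mono norm_ge_zero)
      show "norm (\<Sum>l\<in>UNIV. \<Sum>m\<in>{0, 1}. dof_t z l m (N_tilde z j k) *\<^sub>R T_coeffs l m)
          \<le> (\<Sum>l\<in>UNIV. \<Sum>m\<in>{0, 1}. 2 * \<sigma> * t l * norm (T_coeffs l m))"
        by (intro sum_norm_le) (simp only: norm_scaleR, intro mult_right_mono dt; simp)
      show "norm (\<Sum>l\<in>UNIV. jump z l (N_tilde z j k) *\<^sub>R J_coeffs l)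
          \<le> (\<Sum>l\<in>UNIV. 2 * \<sigma> * s l * norm (J_coeffs l))"
        by (intro sum_norm_le) (simp only: norm_scaleR, intro mult_right_mono js; simp)
    qed
    finally show ?thesis .
  qed
  then show ?thesis
    by blast
qed

text \<open>The corrections do not affect the normal-normal traces at the vertices. At the second end point of
\<open>E\<^sub>j\<close> such a trace equals \<open>e\<^sub>j\<^sup>2 / det B\<close>, and it is a bounded functional of the
coefficients.\<close>

lemma N_coeffs_lower:
  assumes \<sigma>: "\<sigma> > 0"
  shows "\<exists>K>0. \<forall>z. parallelogram z \<and> shape_regular \<sigma> z \<longrightarrow> K \<le> norm (parallelogram_element.N_coeffs z j k)"
proof -
  let ?f = "\<lambda>c. tr_n ref_vertex j (hat_field c) (ref_vertex (j + 1))"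
  obtain M where M: "M > 0" "\<And>c. norm (?f c) \<le> M * norm c"
    using linear_bounded_pos[OF linear_tr_n_hat_field[of j "ref_vertex (j + 1)"]] by blast
  have "1 / (2 * \<sigma> * M) \<le> norm (parallelogram_element.N_coeffs z j k)"
    if z: "parallelogram z" "shape_regular \<sigma> z" for z
  proof -
    interpret parallelogram_element z
      by standard (rule z)
    have "?f (N_coeffs j k) = (edge_len z j)\<^sup>2 / det B"
      unfolding N_coeffs_def linear_diff[OF linear_tr_n_hat_field]
        linear_sum[OF linear_tr_n_hat_field] linear_cmul[OF linear_tr_n_hat_field]
      by (simp add: T_coeffs_traces J_coeffs_traces N_tilde_coeffs_traces)
    then have "1 / (2 * \<sigma>) \<le> ?f (N_coeffs j k)"
      using shape_regular_estimates(2)[OF z(2) \<sigma>] by simp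
    also have "\<dots> \<le> M * norm (N_coeffs j k)"
      using M(2)[of "N_coeffs j k"] by simp
    finally show ?thesis
      using M(1) \<sigma> by (simp add: field_simps)
  qed
  then show ?thesis
    using M(1) \<sigma> by (intro exI[of _ "1 / (2 * \<sigma> * M)"]) simp
qed

definition dof_coeffs :: "vertices \<Rightarrow> dof \<Rightarrow> coeffs" where
  "dof_coeffs z i = (case i of Normal j k \<Rightarrow> parallelogram_element.N_coeffs z j k
     | Tangential j k \<Rightarrow> T_coeffs j k | Corner j \<Rightarrow> J_coeffs j)"

lemma (in parallelogram_element) dof_tensor_eq: "dof_tensor z i = piola (dof_coeffs z i)"
  by (cases i) (simp_all add: dof_coeffs_def N_tensor_eq T_tensor_eq J_tensor_eq)

lemma T_J_coeffs_nonzero: "k \<in> {0, 1} \<Longrightarrow> T_coeffs j k \<noteq> 0" "J_coeffs j \<noteq> 0"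
proof -
  show "k \<in> {0, 1} \<Longrightarrow> T_coeffs j k \<noteq> 0"
    using T_coeffs_traces(4)[of j j k] linear_0[OF linear_tr_t_hat_field[of j "ref_vertex j"]] by auto
  show "J_coeffs j \<noteq> 0"
    using J_coeffs_traces(5)[of j j] linear_0[OF linear_tn_comp_hat_field[of j "ref_vertex j"]]
      linear_0[OF linear_tn_comp_hat_field[of "j - 1" "ref_vertex j"]] by auto
qed

lemma dof_coeffs_bounds:
  assumes \<sigma>: "\<sigma> > 0" and "i \<in> dofs"
  shows "\<exists>r>0. \<exists>R>0. \<forall>z. parallelogram z \<and> shape_regular \<sigma> z \<longrightarrow>
    r \<le> norm (dof_coeffs z i) \<and> norm (dof_coeffs z i) \<le> R"
proof (cases i)
  case (Normal j k)
  obtain K where K: "\<And>z. parallelogram z \<and> shape_regular \<sigma> z \<Longrightarrow> norm (parallelogram_element.N_coeffs z j k) \<le> K"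
    using N_coeffs_upper[OF \<sigma>] by blast
  obtain r where r: "r > 0"
    "\<And>z. parallelogram z \<and> shape_regular \<sigma> z \<Longrightarrow> r \<le> norm (parallelogram_element.N_coeffs z j k)"
    using N_coeffs_lower[OF \<sigma>] by blast
  have "norm (parallelogram_element.N_coeffs z j k) \<le> max K 1" if "parallelogram z \<and> shape_regular \<sigma> z" for z
    using K[OF that] by simp
  with r show ?thesis
    by (intro exI[of _ r] conjI exI[of _ "max K 1"]) (simp_all add: Normal dof_coeffs_def)
next
  case (Tangential j k)
  with assms(2) have "T_coeffs j k \<noteq> 0"
    using T_J_coeffs_nonzero(1) by simp
  then show ?thesis
    by (intro exI[of _ "norm (T_coeffs j k)"] conjI) (simp_all add: Tangential dof_coeffs_def)
next
  case (Corner j)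
  have "J_coeffs j \<noteq> 0"
    by (rule T_J_coeffs_nonzero)
  then show ?thesis
    by (intro exI[of _ "norm (J_coeffs j)"] conjI) (simp_all add: Corner dof_coeffs_def)
qed

lemma dof_tensor_scaling:
  assumes \<sigma>: "\<sigma> > 0" and i: "i \<in> dofs"
  shows "\<exists>c>0. \<exists>C>0. \<forall>z. parallelogram z \<and> shape_regular \<sigma> z \<longrightarrow>
    c * diameter (element z) \<le> L2_norm_on (element z) (dof_tensor z i) \<and>
    L2_norm_on (element z) (dof_tensor z i) \<le> C * diameter (element z)"
proof -
  obtain q Q where q: "q > 0" "Q > 0" "\<And>c. q * (norm c)\<^sup>2 \<le> mass c" "\<And>c. mass c \<le> Q * (norm c)\<^sup>2"
    by (rule mass_equiv_norm) blast
  obtain r R where r: "r > 0" "R > 0" "\<And>z. parallelogram z \<and> shape_regular \<sigma> z \<Longrightarrow>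
      r \<le> norm (dof_coeffs z i) \<and> norm (dof_coeffs z i) \<le> R"
    using dof_coeffs_bounds[OF assms] by blast
  let ?c = "sqrt (q * r\<^sup>2 / (32 * \<sigma> ^ 3))" and ?C = "sqrt (8 * \<sigma> * (Q * R\<^sup>2))"
  have "?c * diameter (element z) \<le> L2_norm_on (element z) (dof_tensor z i) \<and>
    L2_norm_on (element z) (dof_tensor z i) \<le> ?C * diameter (element z)"
    if z: "parallelogram z \<and> shape_regular \<sigma> z" for z
  proof -
    interpret parallelogram_element z
      by standard (use z in simp)
    let ?h = "diameter (element z)" and ?x = "dof_coeffs z i"
    have "q * r\<^sup>2 \<le> q * (norm ?x)\<^sup>2"
      using r(1) r(3)[OF z] q(1) by (intro mult_left_mono power_mono) auto
    also have "\<dots> \<le> mass ?x"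
      by (rule q)
    finally have "?c * ?h \<le> sqrt (mass ?x / (32 * \<sigma> ^ 3)) * ?h"
      using diameter_pos \<sigma> by (intro mult_right_mono real_sqrt_le_mono divide_right_mono) auto
    moreover have "Q * (norm ?x)\<^sup>2 \<le> Q * R\<^sup>2"
      using r(3)[OF z] q(2) by (intro mult_left_mono power_mono) auto
    then have "mass ?x \<le> Q * R\<^sup>2"
      using q(4)[of ?x] by linarith
    then have "sqrt (8 * \<sigma> * mass ?x) * ?h \<le> ?C * ?h"
      using diameter_pos \<sigma> by (intro mult_right_mono real_sqrt_le_mono mult_left_mono) auto
    ultimately show ?thesis
      using L2_norm_piola_scaling[OF _ \<sigma>, of ?x] z unfolding dof_tensor_eq by force
  qed
  moreover have "?c > 0" "?C > 0"
    using q r \<sigma> by simp_all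
  ultimately show ?thesis
    by blast
qed

lemma finite_uniform_equivalence:
  fixes v :: "'i \<Rightarrow> 'z \<Rightarrow> real" and h :: "'z \<Rightarrow> real"
  assumes "finite I" and h: "\<And>z. P z \<Longrightarrow> h z \<ge> 0"
    and "\<And>i. i \<in> I \<Longrightarrow> \<exists>c>0. \<exists>C>0. \<forall>z. P z \<longrightarrow> c * h z \<le> v i z \<and> v i z \<le> C * h z"
  shows "\<exists>c>0. \<exists>C>0. \<forall>z. P z \<longrightarrow> (\<forall>i\<in>I. c * h z \<le> v i z \<and> v i z \<le> C * h z)"
  using assms(1,3)
proof (induction I rule: finite_induct)
  case empty
  show ?case
    by (rule exI[of _ 1], rule conjI[OF zero_less_one], rule exI[of _ 1]) simp
next
  case (insert i I)
  from insert.IH[OF insert.prems[OF insertI2]] obtain c C where c: "c > 0" "C > 0"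
    "\<And>z i. P z \<Longrightarrow> i \<in> I \<Longrightarrow> c * h z \<le> v i z \<and> v i z \<le> C * h z"
    by blast
  from insert.prems[of i] obtain d D where d: "d > 0" "D > 0"
    "\<And>z. P z \<Longrightarrow> d * h z \<le> v i z \<and> v i z \<le> D * h z"
    by blast
  have "min c d * h z \<le> v j z \<and> v j z \<le> max C D * h z" if z: "P z" and j: "j \<in> insert i I" for z j
  proof -
    have "min c d * h z \<le> c * h z" "min c d * h z \<le> d * h z"
      "C * h z \<le> max C D * h z" "D * h z \<le> max C D * h z"
      using h[OF z] by (auto intro: mult_right_mono)
    with j c(3)[OF z, of j] d(3)[OF z] show ?thesis
      by (cases "j = i") auto
  qed
  with c d show ?case
    by (intro exI[of _ "min c d"] conjI exI[of _ "max C D"]) auto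
qed

theorem theorem28:
  shows "(\<forall>z. parallelogram z \<longrightarrow>
            independent (basis_tensors z) \<and> span (basis_tensors z) = X_space z \<and>
            (\<forall>j l. \<forall>k\<in>{0, 1}. \<forall>m\<in>{0, 1}.
               dof_n z l m (N_tensor z j k) = (if (l, m) = (j, k) then 1 else 0) \<and>
               dof_t z l m (N_tensor z j k) = 0 \<and>
               jump z l (N_tensor z j k) = 0 \<and>
               dof_n z l m (T_tensor z j k) = 0 \<and>
               dof_t z l m (T_tensor z j k) = (if (l, m) = (j, k) then 1 else 0) \<and>
               jump z l (T_tensor z j k) = 0 \<and>
               dof_n z l m (J_tensor z j) = 0 \<and>
               dof_t z l m (J_tensor z j) = 0 \<and>
               jump z l (J_tensor z j) = (if l = j then 1 else 0)))
       \<and> (\<forall>\<sigma>>0. \<exists>c>0. \<exists>C>0. \<forall>z. parallelogram z \<and> shape_regular \<sigma> z \<longrightarrow>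
            (\<forall>B\<in>basis_tensors z.
               c * diameter (element z) \<le> L2_norm_on (element z) B \<and>
               L2_norm_on (element z) B \<le> C * diameter (element z)))"
proof (intro conjI allI impI ballI)
  fix z :: vertices and j l :: 4 and k m :: nat
  assume z: "parallelogram z"
  interpret parallelogram_element z
    by standard (rule z)
  show "independent (basis_tensors z)" "span (basis_tensors z) = X_space z"
    by (rule basis)+
  assume k: "k \<in> {0, 1}" and m: "m \<in> {0, 1}"
  show "dof_n z l m (N_tensor z j k) = (if (l, m) = (j, k) then 1 else 0)"
    "dof_t z l m (N_tensor z j k) = 0" "jump z l (N_tensor z j k) = 0"
    by (rule N_dofs[OF m k])+
  show "dof_n z l m (T_tensor z j k) = 0"
    "dof_t z l m (T_tensor z j k) = (if (l, m) = (j, k) then 1 else 0)"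
    "jump z l (T_tensor z j k) = 0"
    by (rule T_dofs[OF m k])+
  show "dof_n z l m (J_tensor z j) = 0" "dof_t z l m (J_tensor z j) = 0"
    "jump z l (J_tensor z j) = (if l = j then 1 else 0)"
    by (rule J_dofs[OF m])+
next
  fix \<sigma> :: real
  assume \<sigma>: "\<sigma> > 0"
  have "diameter (element z) \<ge> 0" if "parallelogram z \<and> shape_regular \<sigma> z" for z
    by (rule diameter_ge_0) (use that parallelogram_element.bounded_element parallelogram_element.intro in blast)
  from finite_uniform_equivalence[where P = "\<lambda>z. parallelogram z \<and> shape_regular \<sigma> z"
      and h = "\<lambda>z. diameter (element z)", OF card_dofs(1) this dof_tensor_scaling[OF \<sigma>]]
  show "\<exists>c>0. \<exists>C>0. \<forall>z. parallelogram z \<and> shape_regular \<sigma> z \<longrightarrow>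
      (\<forall>B\<in>basis_tensors z. c * diameter (element z) \<le> L2_norm_on (element z) B \<and>
         L2_norm_on (element z) B \<le> C * diameter (element z))"
    by (simp only: basis_tensors_eq ball_simps)
qed

end
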